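(* Let $f_1,\ldots,f_N:\mathbb{R}^n\to\mathbb{R}$, $D_1,\ldots,D_N:\mathbb{R}^n\rightrightarrows\mathbb{R}^n$ and $g:\mathbb{R}^n\to\overline{\mathbb{R}}$ satisfy the standing assumption stated in the context, with $\Phi:=f_1+\cdots+f_N+g$ and $D_\Phi:=D_1+\cdots+D_N+\partial g$. For any compact set $X_0\subset\operatorname{dom}\Phi$ and $\epsilon,T>0$, there exists $\bar\alpha>0$ such that for any sequence $(x_k)_{k\in\mathbb{N}}$ generated by proximal random reshuffling (PRR) initialized in $X_0$ with $\alpha_0,\alpha_1,\ldots\in(0,\bar\alpha]$, there exists a solution $x:[0,T]\to\operatorname{dom}\Phi$ to $x'\in-D_\Phi(x)$ such that $x(0)\in X_0$ and $$\forall k\in\{1,2,\ldots\},\quad \alpha_0+\cdots+\alpha_{k-1}\leqslant T\ \Longrightarrow\ \|x_k-x(\alpha_0+\cdots+\alpha_{k-1})\|\leqslant\epsilon.$$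
   Context: Notation: $\mathbb{R}^n$ carries an inner product $\langle\cdot,\cdot\rangle$ with induced norm $\|\cdot\|$; $\overline{\mathbb{R}}=\mathbb{R}\cup\{\pm\infty\}$; $\mathbb{N}=\{0,1,2,\ldots\}$; $\operatorname{dom}\Phi=\{x:\Phi(x)<\infty\}$. A set-valued map $D$ is locally bounded if every point has a neighborhood $U$ with $D(U)=\bigcup_{x\in U}D(x)$ bounded. Conservative field: for a locally Lipschitz $f:\mathbb{R}^n\to\mathbb{R}$, a set-valued map $D:\mathbb{R}^n\rightrightarrows\mathbb{R}^n$ with closed graph and nonempty compact values is a conservative field for $f$ if for every absolutely continuous curve $\gamma:[0,1]\to\mathbb{R}^n$, for almost every $t\in[0,1]$, $\frac{d}{dt}f(\gamma(t))=\langle v,\gamma'(t)\rangle$ for all $v\in D(\gamma(t))$. Standing assumption: (1) $f_1,\ldots,f_N$ ($N\geqslant 1$) are locally Lipschitz; (2) each $D_i$ is a locally bounded conservative field with nonempty convex values for $f_i$; (3) $g$ is proper and convex, its domain is closed, and $g$ is locally Lipschitz on its domain; (4) $\Phi:=f+g$ is bounded below, where $f:=f_1+\cdots+f_N$, and $D_\Phi:=\sum_{i=1}^N D_i+\partial g$, where $\partial g$ is the convex subdifferential. A function $x:[0,T]\to\mathbb{R}^n$ is a solution to $x'\in-D(x)$ if it is absolutely continuous and $x'(t)\in-D(x(t))$ for almost every $t\in[0,T]$. PRR algorithm: given step sizes $\alpha_0,\alpha_1,\ldots>0$ and $x_0\in\operatorname{dom}\Phi$, for $k=0,1,2,\ldots$: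 set $x_{k,0}=x_k$; choose an arbitrary permutation $\sigma^k$ of $\{1,\ldots,N\}$; for $i=1,\ldots,N$ choose $x_{k,i}\in x_{k,i-1}-\alpha_k D_{\sigma^k_i}(x_{k,i-1})$; set $x_{k+1}=\operatorname{prox}_{\alpha_k g}(x_{k,N})$, where $\operatorname{prox}_{h}(x)=\operatorname{argmin}_{y\in\mathbb{R}^n}\{h(y)+\|y-x\|^2/2\}$. "Initialized in $X_0$" means $x_0\in X_0$. *)

theory Defs
  imports "HOL-Analysis.Analysis" "HOL-Library.Set_Algebras"
begin

(* R^n with an inner product is rendered as a type of class euclidean_space,
   a set-valued map as a function into sets. *)

definition eff_dom :: "('a \<Rightarrow> ereal) \<Rightarrow> 'a set" where
  "eff_dom h = {x. h x < \<infinity>}"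

definition proper_fun :: "('a \<Rightarrow> ereal) \<Rightarrow> bool" where
  "proper_fun h \<longleftrightarrow> (\<forall>x. h x \<noteq> -\<infinity>) \<and> (\<exists>x. h x \<noteq> \<infinity>)"

(* Convexity of an extended-real-valued function, as convexity of its epigraph in 'a \<times> R. *)
definition convex_ereal :: "('a::real_vector \<Rightarrow> ereal) \<Rightarrow> bool" where
  "convex_ereal h \<longleftrightarrow> convex {(x, r::real). h x \<le> ereal r}"

definition locally_lipschitz_on :: "'a::metric_space set \<Rightarrow> ('a \<Rightarrow> 'b::metric_space) \<Rightarrow> bool" where
  "locally_lipschitz_on S h \<longleftrightarrow>
    (\<forall>x\<in>S. \<exists>r>0. \<exists>L. L-lipschitz_on (ball x r \<inter> S) h)"

(* A pair (a, b) in I stands for the interval [a, b]; the intervals in I are finitely many,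
   contained in S and non-overlapping. *)
definition abs_continuous_on :: "real set \<Rightarrow> (real \<Rightarrow> 'a::real_normed_vector) \<Rightarrow> bool" where
  "abs_continuous_on S \<gamma> \<longleftrightarrow>
    (\<forall>\<epsilon>>0. \<exists>\<delta>>0. \<forall>I :: (real \<times> real) set.
      finite I \<and> (\<forall>(a, b)\<in>I. a \<le> b \<and> {a..b} \<subseteq> S) \<and>
      disjoint_family_on (\<lambda>(a, b). {a<..<b}) I \<and> (\<Sum>(a, b)\<in>I. b - a) < \<delta>
      \<longrightarrow> (\<Sum>(a, b)\<in>I. norm (\<gamma> b - \<gamma> a)) < \<epsilon>)"

definition locally_bounded_map :: "('a::metric_space \<Rightarrow> 'b::metric_space set) \<Rightarrow> bool" where
  "locally_bounded_map D \<longleftrightarrow> (\<forall>x. \<exists>U. open U \<and> x \<in> U \<and> bounded (\<Union>y\<in>U. D y))"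

(* The chain rule includes the existence of both derivatives at almost every t. *)
definition conservative_field ::
  "('a::euclidean_space \<Rightarrow> real) \<Rightarrow> ('a \<Rightarrow> 'a set) \<Rightarrow> bool" where
  "conservative_field h D \<longleftrightarrow>
    locally_lipschitz_on UNIV h \<and>
    closed {(x, v). v \<in> D x} \<and>
    (\<forall>x. D x \<noteq> {} \<and> compact (D x)) \<and>
    (\<forall>\<gamma>. abs_continuous_on {0..1} \<gamma> \<longrightarrow>
      (AE t in lebesgue_on {0..1}. \<exists>\<gamma>'.
        (\<gamma> has_vector_derivative \<gamma>') (at t within {0..1}) \<and>
        (\<forall>v\<in>D (\<gamma> t). ((\<lambda>s. h (\<gamma> s)) has_real_derivative v \<bullet> \<gamma>') (at t within {0..1}))))"

(* For proper h this is empty outside the effective domain of h. *)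
definition convex_subdifferential ::
  "('a::real_inner \<Rightarrow> ereal) \<Rightarrow> 'a \<Rightarrow> 'a set" where
  "convex_subdifferential h x = {v. \<forall>y. h x + ereal (v \<bullet> (y - x)) \<le> h y}"

definition objective ::
  "nat \<Rightarrow> (nat \<Rightarrow> 'a \<Rightarrow> real) \<Rightarrow> ('a \<Rightarrow> ereal) \<Rightarrow> 'a \<Rightarrow> ereal" where
  "objective N f g x = ereal (\<Sum>i=1..N. f i x) + g x"

(* Sums of sets are Minkowski sums. *)
definition objective_field ::
  "nat \<Rightarrow> (nat \<Rightarrow> 'a::real_inner \<Rightarrow> 'a set) \<Rightarrow> ('a \<Rightarrow> ereal) \<Rightarrow> 'a \<Rightarrow> 'a set" where
  "objective_field N D g x = (\<Sum>i=1..N. D i x) + convex_subdifferential g x"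

definition inclusion_solution ::
  "real \<Rightarrow> ('a::euclidean_space \<Rightarrow> 'a set) \<Rightarrow> (real \<Rightarrow> 'a) \<Rightarrow> bool" where
  "inclusion_solution T D x \<longleftrightarrow>
    abs_continuous_on {0..T} x \<and>
    (AE t in lebesgue_on {0..T}.
      \<exists>v\<in>D (x t). (x has_vector_derivative - v) (at t within {0..T}))"

(* The set of minimizers: a singleton when h is proper, convex and lower semicontinuous. *)
definition prox :: "('a::real_normed_vector \<Rightarrow> ereal) \<Rightarrow> 'a \<Rightarrow> 'a set" where
  "prox h x = {y. is_arg_min (\<lambda>y. h y + ereal ((norm (y - x))\<^sup>2 / 2)) (\<lambda>_. True) y}"

(* \<sigma> k is the permutation of epoch k, and z k i is the inner iterate x_{k,i}. *)
definition prr_sequence ::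
  "nat \<Rightarrow> (nat \<Rightarrow> 'a::euclidean_space \<Rightarrow> real) \<Rightarrow> (nat \<Rightarrow> 'a \<Rightarrow> 'a set) \<Rightarrow> ('a \<Rightarrow> ereal) \<Rightarrow>
   (nat \<Rightarrow> real) \<Rightarrow> (nat \<Rightarrow> 'a) \<Rightarrow> bool" where
  "prr_sequence N f D g \<alpha> x \<longleftrightarrow>
    (\<forall>k. 0 < \<alpha> k) \<and> x 0 \<in> eff_dom (objective N f g) \<and>
    (\<exists>(\<sigma> :: nat \<Rightarrow> nat \<Rightarrow> nat) (z :: nat \<Rightarrow> nat \<Rightarrow> 'a). \<forall>k.
      \<sigma> k permutes {1..N} \<and>
      z k 0 = x k \<and>
      (\<forall>i\<in>{1..N}. \<exists>v\<in>D (\<sigma> k i) (z k (i - 1)). z k i = z k (i - 1) - \<alpha> k *\<^sub>R v) \<and>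
      x (Suc k) \<in> prox (\<lambda>y. ereal (\<alpha> k) * g y) (z k N))"

end

theory Submission
  imports Defs "HOL-Complex_Analysis.Great_Picard"
begin

text \<open>If the claim failed, there would be runs with step sizes tending to zero that stay away from
  all solutions. Their polygonal interpolations are equi-Lipschitz, so by Arzela-Ascoli a
  subsequence converges uniformly. Difference quotients of a polygon are convex combinations of the
  velocities of nearby epochs, and these lie close to \<open>- D\<^sub>\<Phi> p\<close> when the iterates are close to \<open>p\<close>:
  the \<open>D\<^sub>i\<close> and \<open>\<partial>g\<close> have closed graph, and the proximal subgradients are bounded because \<open>g\<close> is
  Lipschitz on its domain. Since \<open>D\<^sub>\<Phi> p\<close> is closed and convex, the limit satisfies the inclusion at
  every point of differentiability. Compactness of the iterates is not automatic: by the chain rule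
  \<open>\<Phi>\<close> decreases along solutions at the rate \<open>|x'|\<^sup>2\<close>, and as \<open>\<Phi>\<close> is bounded below, solutions stay
  in a fixed ball, which the iterates cannot leave before time \<open>T\<close> either.\<close>

section \<open>Curves on an interval\<close>

text \<open>The obstacle is a circularity. Estimates for one epoch are uniform only on bounded sets,
  boundedness of the iterates has to come from solutions, and a limit curve is known to be a
  solution only where those estimates hold. It is broken by fixing a radius \<open>R\<close> beyond
  the a priori bound and stopping a run as soon as it leaves that ball. Limits of stopped runs
  satisfy the inclusion where their norm is below \<open>R\<close>; a first-exit argument shows that
  they never reach norm \<open>R\<close>; and a stopped run close enough to such a limit was in fact
  never stopped before time \<open>T\<close>. Arguing by contradiction makes the threshold for the
  step sizes uniform over all runs, whatever the permutations and selections. The order within an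
  epoch disappears in the limit because each component is used exactly once, at a point whose
  distance from the start of the epoch is at most a constant times the step size.\<close>

lemma AE_lebesgue_on_iff_negligible:
  assumes "S \<in> sets lebesgue"
  shows "(AE t in lebesgue_on S. P t) \<longleftrightarrow> negligible {t \<in> S. \<not> P t}"
proof -
  have "(AE t in lebesgue_on S. P t) \<longleftrightarrow> (AE t in lebesgue. t \<in> S \<longrightarrow> P t)"
    using assms by (simp add: AE_restrict_space_iff)
  also have "\<dots> \<longleftrightarrow> {t \<in> S. \<not> P t} \<in> null_sets lebesgue"
  proof
    assume "AE t in lebesgue. t \<in> S \<longrightarrow> P t"
    then obtain E where "E \<in> null_sets lebesgue" "{t \<in> S. \<not> P t} \<subseteq> E"
      by (auto simp: eventually_ae_filter)
    then show "{t \<in> S. \<not> P t} \<in> null_sets lebesgue"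
      using null_sets_completion_subset by blast
  qed (auto simp: eventually_ae_filter)
  finally show ?thesis by (simp add: negligible_iff_null_sets)
qed

lemma negligible_lipschitz_image:
  fixes h :: "'a::euclidean_space \<Rightarrow> 'a"
  assumes "L-lipschitz_on S h" "negligible E" "E \<subseteq> S"
  shows "negligible (h ` E)"
proof (rule negligible_locally_Lipschitz_image)
  fix x assume "x \<in> E"
  then have "\<forall>y\<in>E \<inter> UNIV. norm (h y - h x) \<le> L * norm (y - x)"
    using assms lipschitz_on_normD[OF assms(1)] by blast
  then show "\<exists>T B. open T \<and> x \<in> T \<and> (\<forall>y\<in>E \<inter> T. norm (h y - h x) \<le> B * norm (y - x))"
    by blast
qed (use assms in auto)

lemma lipschitz_imp_abs_continuous_on:
  assumes "L-lipschitz_on S \<gamma>"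
  shows "abs_continuous_on S \<gamma>"
  unfolding abs_continuous_on_def
proof (intro allI impI)
  fix e :: real assume "0 < e"
  have L: "0 \<le> L" using assms lipschitz_on_nonneg by blast
  show "\<exists>\<delta>>0. \<forall>I :: (real \<times> real) set.
      finite I \<and> (\<forall>(a, b)\<in>I. a \<le> b \<and> {a..b} \<subseteq> S) \<and>
      disjoint_family_on (\<lambda>(a, b). {a<..<b}) I \<and> (\<Sum>(a, b)\<in>I. b - a) < \<delta>
      \<longrightarrow> (\<Sum>(a, b)\<in>I. norm (\<gamma> b - \<gamma> a)) < e"
  proof (intro exI[of _ "e / (L + 1)"] conjI allI impI)
    show "0 < e / (L + 1)" using \<open>0 < e\<close> L by simp
    fix I :: "(real \<times> real) set"
    assume I: "finite I \<and> (\<forall>(a, b)\<in>I. a \<le> b \<and> {a..b} \<subseteq> S) \<and>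
      disjoint_family_on (\<lambda>(a, b). {a<..<b}) I \<and> (\<Sum>(a, b)\<in>I. b - a) < e / (L + 1)"
    have nn: "0 \<le> (\<Sum>(a, b)\<in>I. b - a)"
      using I by (intro sum_nonneg) auto
    have "(\<Sum>(a, b)\<in>I. norm (\<gamma> b - \<gamma> a)) \<le> (\<Sum>(a, b)\<in>I. L * (b - a))"
    proof (rule sum_mono, clarify)
      fix a b assume "(a, b) \<in> I"
      then have "a \<le> b" "{a..b} \<subseteq> S" using I by auto
      then have "a \<in> S" "b \<in> S" by auto
      then show "norm (\<gamma> b - \<gamma> a) \<le> L * (b - a)"
        using lipschitz_on_normD[OF assms, of b a] \<open>a \<le> b\<close> by simp
    qed
    also have "\<dots> = L * (\<Sum>(a, b)\<in>I. b - a)"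
      by (simp add: sum_distrib_left case_prod_unfold)
    also have "\<dots> \<le> (L + 1) * (\<Sum>(a, b)\<in>I. b - a)"
      using nn by (simp add: algebra_simps)
    also have "\<dots> < e"
      using I L by (simp add: field_simps)
    finally show "(\<Sum>(a, b)\<in>I. norm (\<gamma> b - \<gamma> a)) < e" .
  qed
qed

text \<open>Takes the place of integrating an almost everywhere derivative. Continuity alone would
  not do, as the Cantor function shows; the Lipschitz bound enters through the preservation of null
  sets.\<close>

lemma lipschitz_deriv_nonpos_imp_le:
  fixes \<phi> :: "real \<Rightarrow> real"
  assumes "a \<le> b" and lip: "L-lipschitz_on {a..b} \<phi>"
    and neg: "negligible {t \<in> {a..b}. \<not> (\<exists>d\<le>0. (\<phi> has_real_derivative d) (at t within {a..b}))}"
      (is "negligible ?E")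
  shows "\<phi> b \<le> \<phi> a"
proof (rule ccontr)
  assume "\<not> \<phi> b \<le> \<phi> a"
  then have less: "\<phi> a < \<phi> b" by simp
  with \<open>a \<le> b\<close> have "a < b" by (metis order_le_less less_irrefl)
  \<comment> \<open>Half of the mean slope: subtracting \<open>e * t\<close> still leaves an
    increase from \<open>a\<close> to \<open>b\<close>, but makes every derivative outside the
    exceptional set strictly negative.\<close>
  define e where "e = (\<phi> b - \<phi> a) / 2 / (b - a)"
  have "b - a \<noteq> 0" using \<open>a < b\<close> by simp
  then have eq: "e * (b - a) = (\<phi> b - \<phi> a) / 2"
    by (rule nonzero_eq_divide_eq[THEN iffD1, OF _ e_def])
  have e: "0 < e" "e * (b - a) < \<phi> b - \<phi> a"
    unfolding eq using less \<open>a < b\<close> by (simp_all add: e_def)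
  define h where "h = (\<lambda>t. \<phi> t - e * t)"
  have hab: "h a < h b" using e by (simp add: h_def algebra_simps)
  have "(L + e)-lipschitz_on {a..b} h"
  proof (rule lipschitz_onI)
    fix s t assume st: "s \<in> {a..b}" "t \<in> {a..b}"
    have "h s - h t = (\<phi> s - \<phi> t) - e * (s - t)" by (simp add: h_def algebra_simps)
    then have "dist (h s) (h t) \<le> \<bar>\<phi> s - \<phi> t\<bar> + e * \<bar>s - t\<bar>"
      using abs_triangle_ineq4[of "\<phi> s - \<phi> t" "e * (s - t)"] e by (simp add: dist_real_def abs_mult)
    then show "dist (h s) (h t) \<le> (L + e) * dist s t"
      using lipschitz_onD[OF lip st] by (simp add: dist_real_def algebra_simps)
  qed (use e lipschitz_on_nonneg[OF lip] in auto)
  then have negh: "negligible (h ` ?E)" and cont: "continuous_on {a..b} h"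
    using neg by (auto intro: negligible_lipschitz_image lipschitz_on_continuous_on)
  \<comment> \<open>Lipschitz maps preserve null sets, so some level \<open>y\<close> between \<open>h a\<close> and \<open>h b\<close> is not
    attained in the exceptional set; the last point where \<open>h\<close> attains it is contradictory.\<close>
  define W where "W = h ` ?E"
  have "\<not> negligible {h a<..<h b}"
    using hab open_not_negligible[of "{h a<..<h b}"] by auto
  then have "\<not> {h a<..<h b} \<subseteq> W"
    using negligible_subset negh unfolding W_def by blast
  then obtain y where "y \<in> {h a<..<h b}" and "y \<notin> W" by blast
  then have yE: "y \<notin> h ` ?E" by (simp only: W_def simp_thms)
  from \<open>y \<in> {h a<..<h b}\<close> have y: "h a < y" "y < h b" by simp_all
  define A where "A = {t \<in> {a..b}. h t \<le> y}"
  have "closed A"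
    using continuous_closed_preimage[OF cont closed_atLeastAtMost, of "{..y}"]
    by (simp add: A_def vimage_def Int_def)
  moreover have "bounded A"
    by (rule bounded_subset[OF bounded_closed_interval[of a b]]) (auto simp: A_def)
  ultimately have "compact A" by (simp add: compact_eq_bounded_closed)
  moreover have "a \<in> A" using y \<open>a < b\<close> by (auto simp: A_def)
  ultimately obtain s where s: "s \<in> A" "\<And>t. t \<in> A \<Longrightarrow> t \<le> s"
    using compact_attains_sup[of A] by blast
  have sab: "s \<in> {a..b}" "h s \<le> y" using s by (auto simp: A_def)
  then have "s < b" using y by (metis atLeastAtMost_iff leD order_le_less)
  have hgt: "y < h t" if "s < t" "t \<le> b" for t
  proof (rule ccontr)
    assume "\<not> y < h t"
    then have "t \<in> A" using that sab by (simp add: A_def)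
    then show False using s(2) that by fastforce
  qed
  have "h s = y"
  proof (rule ccontr)
    assume "h s \<noteq> y"
    then have "h s < y" using sab by simp
    then obtain r where r: "s \<le> r" "r \<le> b" "h r = y"
      using IVT'[of h s y b] y \<open>s < b\<close> sab continuous_on_subset[OF cont, of "{s..b}"] by auto
    then show False using hgt[of r] \<open>h s < y\<close> by (cases "r = s") auto
  qed
  then have "s \<notin> ?E" using yE by blast
  then obtain d where d: "d \<le> 0" "(\<phi> has_real_derivative d) (at s within {a..b})"
    using sab by auto
  then have "(h has_real_derivative d - e) (at s within {a..b})"
    unfolding h_def by (auto intro!: derivative_eq_intros)
  then obtain \<delta> where \<delta>: "\<delta> > 0" "\<And>t. t > 0 \<Longrightarrow> s + t \<in> {a..b} \<Longrightarrow> t < \<delta> \<Longrightarrow> h (s + t) < h s"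
    using has_real_derivative_neg_dec_right[of h "d - e" s "{a..b}"] d e by auto
  define t where "t = min (\<delta> / 2) (b - s)"
  have "h (s + t) < h s"
    using \<delta> \<open>s < b\<close> sab by (intro \<delta>(2)) (auto simp: t_def)
  moreover have "y < h (s + t)"
    using \<delta>(1) \<open>s < b\<close> by (intro hgt) (auto simp: t_def)
  ultimately show False using \<open>h s = y\<close> by simp
qed

text \<open>The definition speaks of curves on the unit interval. The time change by the factor
  \<open>T\<close> carries null sets to null sets and multiplies both sides of the chain rule by the
  same factor.\<close>

lemma conservative_field_chain_rule:
  assumes cf: "conservative_field h D" and lip: "L-lipschitz_on {0..T} x" and T: "0 < T"
  shows "negligible {t \<in> {0..T}. \<not> (\<exists>x'. (x has_vector_derivative x') (at t within {0..T}) \<and>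
    (\<forall>v\<in>D (x t). ((\<lambda>s. h (x s)) has_real_derivative v \<bullet> x') (at t within {0..T})))}"
    (is "negligible {t \<in> _. \<not> ?P t}")
proof -
  define \<gamma> where "\<gamma> = (\<lambda>\<tau>. x (T * \<tau>))"
  have "(L * T)-lipschitz_on {0..1} \<gamma>"
  proof (rule lipschitz_onI)
    fix s t :: real assume st: "s \<in> {0..1}" "t \<in> {0..1}"
    have "dist (\<gamma> s) (\<gamma> t) \<le> L * dist (T * s) (T * t)"
      unfolding \<gamma>_def using st T by (intro lipschitz_onD[OF lip]) auto
    also have "\<dots> = L * T * dist s t"
      using T by (simp add: dist_real_def flip: right_diff_distrib) (simp add: abs_mult)
    finally show "dist (\<gamma> s) (\<gamma> t) \<le> L * T * dist s t" .
  qed (use T lipschitz_on_nonneg[OF lip] in auto)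
  then have "abs_continuous_on {0..1} \<gamma>"
    by (rule lipschitz_imp_abs_continuous_on)
  with cf have "AE t in lebesgue_on {0..1}. \<exists>\<gamma>'.
        (\<gamma> has_vector_derivative \<gamma>') (at t within {0..1}) \<and>
        (\<forall>v\<in>D (\<gamma> t). ((\<lambda>s. h (\<gamma> s)) has_real_derivative v \<bullet> \<gamma>') (at t within {0..1}))"
    (is "AE t in _. ?Q t")
    unfolding conservative_field_def by blast
  then have "negligible {t \<in> {0..1}. \<not> ?Q t}"
    by (subst (asm) AE_lebesgue_on_iff_negligible) auto
  then have "negligible ((\<lambda>t. T * t) ` {t \<in> {0..1}. \<not> ?Q t})"
    by (rule negligible_differentiable_image_negligible[rotated]) (auto intro!: derivative_intros)
  moreover have "{t \<in> {0..T}. \<not> ?P t} \<subseteq> (\<lambda>t. T * t) ` {t \<in> {0..1}. \<not> ?Q t}"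
  proof
    fix t assume "t \<in> {t \<in> {0..T}. \<not> ?P t}"
    then have t: "t \<in> {0..T}" "\<not> ?P t" by auto
    have im: "(\<lambda>s. s / T) ` {0..T} = {0..1}"
      using T by (auto simp: image_iff intro!: bexI[of _ "T * _"])
    have xeq: "x = \<gamma> \<circ> (\<lambda>s. s / T)" using T by (auto simp: \<gamma>_def)
    have "\<not> ?Q (t / T)"
    proof
      assume "?Q (t / T)"
      then obtain \<gamma>' where g: "(\<gamma> has_vector_derivative \<gamma>') (at (t / T) within {0..1})"
        and hg: "\<And>v. v \<in> D (\<gamma> (t / T)) \<Longrightarrow>
          ((\<lambda>s. h (\<gamma> s)) has_real_derivative v \<bullet> \<gamma>') (at (t / T) within {0..1})" by blast
      have d: "((\<lambda>s. s / T) has_real_derivative 1 / T) (at t within {0..T})"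
        using T by (auto intro!: derivative_eq_intros)
      have "(x has_vector_derivative (1 / T) *\<^sub>R \<gamma>') (at t within {0..T})"
        unfolding xeq
        by (rule vector_diff_chain_within) (use d g im in \<open>simp_all add: has_real_derivative_iff_has_vector_derivative\<close>)
      moreover have "((\<lambda>s. h (x s)) has_real_derivative v \<bullet> ((1 / T) *\<^sub>R \<gamma>')) (at t within {0..T})"
        if "v \<in> D (x t)" for v
        using DERIV_image_chain[of "\<lambda>s. h (\<gamma> s)" "v \<bullet> \<gamma>'" "\<lambda>s. s / T" t "{0..T}" "1 / T"] that hg[of v] d im
        by (simp add: xeq o_def)
      ultimately show False using t by blast
    qed
    then show "t \<in> (\<lambda>t. T * t) ` {t \<in> {0..1}. \<not> ?Q t}"
      using t T by (intro image_eqI[of _ _ "t / T"]) auto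
  qed
  ultimately show ?thesis using negligible_subset by blast
qed

section \<open>Convex functions and proximal steps\<close>

text \<open>Finite subcover, with the sum of the local constants as a common one; monotonicity in
  \<open>L\<close> lets the larger constant replace each local one. It serves both the slopes of
  \<open>g\<close> and the bounds on the \<open>D i\<close>.\<close>

lemma compact_uniform_bound:
  fixes P :: "real \<Rightarrow> 'a::topological_space \<Rightarrow> bool"
  assumes "compact K"
    and loc: "\<And>x. x \<in> K \<Longrightarrow> \<exists>U L. open U \<and> x \<in> U \<and> (\<forall>y\<in>U \<inter> K. P L y)"
    and mono: "\<And>L L' y. P L y \<Longrightarrow> L \<le> L' \<Longrightarrow> P L' y"
  shows "\<exists>L\<ge>0. \<forall>x\<in>K. P L x"
proof -
  have "\<forall>x\<in>K. \<exists>p. open (fst p) \<and> x \<in> fst p \<and> (\<forall>y\<in>fst p \<inter> K. P (snd p) y)"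
  proof
    fix x assume "x \<in> K"
    then obtain U L where "open U \<and> x \<in> U \<and> (\<forall>y\<in>U \<inter> K. P L y)" using loc by blast
    then show "\<exists>p. open (fst p) \<and> x \<in> fst p \<and> (\<forall>y\<in>fst p \<inter> K. P (snd p) y)"
      by (intro exI[of _ "(U, L)"]) simp
  qed
  then obtain q where q: "\<forall>x\<in>K. open (fst (q x)) \<and> x \<in> fst (q x) \<and> (\<forall>y\<in>fst (q x) \<inter> K. P (snd (q x)) y)"
    by (rule bchoice[THEN exE])
  define U L where "U = (\<lambda>x. fst (q x))" and "L = (\<lambda>x. snd (q x))"
  have UL: "\<And>x. x \<in> K \<Longrightarrow> open (U x) \<and> x \<in> U x \<and> (\<forall>y\<in>U x \<inter> K. P (L x) y)"
    using q by (simp add: U_def L_def)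
  then obtain C where C: "C \<subseteq> K" "finite C" "K \<subseteq> (\<Union>c\<in>C. U c)"
    using compactE_image[OF \<open>compact K\<close>, of K U] UL by (metis UN_I subsetI)
  show ?thesis
  proof (intro exI conjI ballI)
    show "0 \<le> (\<Sum>c\<in>C. \<bar>L c\<bar>)" by (simp add: sum_nonneg)
    fix x assume "x \<in> K"
    then obtain c where c: "c \<in> C" "x \<in> U c" using C by auto
    then have "P (L c) x" using UL \<open>x \<in> K\<close> C by blast
    moreover have "L c \<le> (\<Sum>c\<in>C. \<bar>L c\<bar>)"
      using member_le_sum[of c C "\<lambda>c. \<bar>L c\<bar>"] c C by fastforce
    ultimately show "P (\<Sum>c\<in>C. \<bar>L c\<bar>) x" using mono by blast
  qed
qed

lemma compact_set_sum:
  fixes S :: "'i \<Rightarrow> 'a::real_normed_vector set"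
  assumes "\<And>i. i \<in> I \<Longrightarrow> compact (S i)"
  shows "compact (\<Sum>i\<in>I. S i)"
  using assms
proof (induction I rule: infinite_finite_induct)
  case (insert i I)
  then have "compact {x + y |x y. x \<in> S i \<and> y \<in> (\<Sum>i\<in>I. S i)}"
    by (intro compact_sums) auto
  moreover have "{x + y |x y. x \<in> S i \<and> y \<in> (\<Sum>i\<in>I. S i)} = S i + (\<Sum>i\<in>I. S i)"
    by (auto simp: set_plus_def)
  ultimately show ?case using insert by simp
qed (auto simp: set_zero)

lemma closed_compact_set_plus:
  fixes S :: "'a::real_normed_vector set"
  assumes "closed S" "compact K"
  shows "closed (S + K)"
proof -
  have "S + K = (\<Union>x\<in>S. \<Union>y\<in>K. {x + y})" by (auto simp: set_plus_def)
  then show ?thesis using closed_compact_sums[OF assms] by simp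
qed

text \<open>The bound \<open>C\<close> is there for subdifferentials, whose values may be unbounded:
  it yields a convergent subsequence of the offending values, and the closed graph puts its limit
  into \<open>F p\<close>. If \<open>F p\<close> is empty, the statement says that no values of norm
  at most \<open>C\<close> occur near \<open>p\<close>.\<close>

lemma closed_graph_upper_semicontinuous:
  fixes F :: "'a::metric_space \<Rightarrow> 'b::euclidean_space set"
  assumes "closed {(x, v). v \<in> F x}" and "0 < \<eta>"
  shows "\<exists>\<delta>>0. \<forall>y\<in>ball p \<delta>. \<forall>v\<in>F y. norm v \<le> C \<longrightarrow> (\<exists>d\<in>F p. norm (v - d) \<le> \<eta>)"
proof (rule ccontr)
  assume "\<not> ?thesis"
  then have neg: "\<exists>y\<in>ball p \<delta>. \<exists>v\<in>F y. norm v \<le> C \<and> (\<forall>d\<in>F p. \<eta> < norm (v - d))" if "0 < \<delta>" for \<delta>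
    using that by (simp add: not_le)
  have "\<forall>n::nat. \<exists>y v. y \<in> ball p (1 / Suc n) \<and> v \<in> F y \<and> norm v \<le> C \<and>
      (\<forall>d\<in>F p. \<eta> < norm (v - d))"
  proof
    fix n :: nat
    have "0 < 1 / real (Suc n)" by simp
    from neg[OF this] show "\<exists>y v. y \<in> ball p (1 / Suc n) \<and> v \<in> F y \<and> norm v \<le> C \<and>
      (\<forall>d\<in>F p. \<eta> < norm (v - d))" by blast
  qed
  then obtain y v where yv: "\<And>n::nat. y n \<in> ball p (1 / Suc n)" "\<And>n. v n \<in> F (y n)"
    "\<And>n. norm (v n) \<le> C" "\<And>n d. d \<in> F p \<Longrightarrow> \<eta> < norm (v n - d)"
    by metis
  have "\<forall>n. v n \<in> cball 0 C" using yv(3) by simp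
  then obtain w r where w: "strict_mono (r :: nat \<Rightarrow> nat)" "(v \<circ> r) \<longlonglongrightarrow> w"
    using compact_cball[of "0::'b" C] unfolding compact_def by metis
  have "y \<longlonglongrightarrow> p"
  proof (rule metric_LIMSEQ_I)
    fix e :: real assume "0 < e"
    then obtain m where m: "1 / Suc m < e" using nat_approx_posE by blast
    have "dist (y n) p < e" if "m \<le> n" for n
    proof -
      have "dist (y n) p < 1 / Suc n" using yv(1)[of n] by (simp add: dist_commute)
      also have "\<dots> \<le> 1 / Suc m" using that by (simp add: frac_le)
      finally show ?thesis using m by simp
    qed
    then show "\<exists>m. \<forall>n\<ge>m. dist (y n) p < e" by blast
  qed
  then have "(y \<circ> r) \<longlonglongrightarrow> p" using w LIMSEQ_subseq_LIMSEQ by blast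
  then have "(\<lambda>n. ((y \<circ> r) n, (v \<circ> r) n)) \<longlonglongrightarrow> (p, w)" using w by (intro tendsto_Pair)
  then have "(p, w) \<in> {(x, v). v \<in> F x}"
    by (rule closed_sequentially[OF assms(1), rotated]) (use yv(2) in auto)
  then have "w \<in> F p" by simp
  then have "\<eta> \<le> norm ((v \<circ> r) n - w)" for n using yv(4)[of w "r n"] by simp
  moreover have "(\<lambda>n. norm ((v \<circ> r) n - w)) \<longlonglongrightarrow> 0"
    by (rule tendsto_norm_zero[OF LIM_zero[OF w(2)]])
  ultimately have "\<eta> \<le> 0" by (meson LIMSEQ_le_const)
  then show False using \<open>0 < \<eta>\<close> by simp
qed

section \<open>Convex functions that are locally Lipschitz on a closed domain\<close>

locale closed_convex_lipschitz =
  fixes g :: "'a::euclidean_space \<Rightarrow> ereal"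
  assumes proper: "proper_fun g" and convex: "convex_ereal g" and closed: "closed (eff_dom g)"
    and lip: "locally_lipschitz_on (eff_dom g) (\<lambda>x. real_of_ereal (g x))"
begin

abbreviation "G \<equiv> eff_dom g"
abbreviation "gr x \<equiv> real_of_ereal (g x)"

lemma on_dom: "x \<in> G \<Longrightarrow> g x = ereal (gr x)"
  using proper unfolding proper_fun_def eff_dom_def by (cases "g x") auto

lemma off_dom: "x \<notin> G \<Longrightarrow> g x = \<infinity>"
  unfolding eff_dom_def by auto

lemma dom_nonempty: "G \<noteq> {}"
  using proper unfolding proper_fun_def eff_dom_def by auto

lemma convex_combination:
  assumes "x \<in> G" "y \<in> G" "0 \<le> s" "s \<le> 1"
  shows "x + s *\<^sub>R (y - x) \<in> G" and "gr (x + s *\<^sub>R (y - x)) \<le> gr x + s * (gr y - gr x)"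
proof -
  have "(x, gr x) \<in> {(x, r::real). g x \<le> ereal r}" "(y, gr y) \<in> {(x, r::real). g x \<le> ereal r}"
    using assms by (auto simp: on_dom[symmetric])
  then have "(1 - s) *\<^sub>R (x, gr x) + s *\<^sub>R (y, gr y) \<in> {(x, r::real). g x \<le> ereal r}"
    using convex assms unfolding convex_ereal_def by (intro convexD) auto
  moreover have "(1 - s) *\<^sub>R x + s *\<^sub>R y = x + s *\<^sub>R (y - x)"
    by (simp add: algebra_simps)
  ultimately have le: "g (x + s *\<^sub>R (y - x)) \<le> ereal ((1 - s) * gr x + s * gr y)" by auto
  then show in_dom: "x + s *\<^sub>R (y - x) \<in> G" by (auto simp: eff_dom_def)
  have "(1 - s) * gr x + s * gr y = gr x + s * (gr y - gr x)" by (simp add: algebra_simps)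
  with le have "g (x + s *\<^sub>R (y - x)) \<le> ereal (gr x + s * (gr y - gr x))" by simp
  then have "ereal (gr (x + s *\<^sub>R (y - x))) \<le> ereal (gr x + s * (gr y - gr x))"
    by (subst (asm) on_dom[OF in_dom])
  then show "gr (x + s *\<^sub>R (y - x)) \<le> gr x + s * (gr y - gr x)" by simp
qed

lemma subdifferential_iff:
  "v \<in> convex_subdifferential g x \<longleftrightarrow> x \<in> G \<and> (\<forall>y\<in>G. gr x + v \<bullet> (y - x) \<le> gr y)"
proof (cases "x \<in> G")
  case True
  have "(g x + ereal (v \<bullet> (y - x)) \<le> g y) \<longleftrightarrow> (y \<in> G \<longrightarrow> gr x + v \<bullet> (y - x) \<le> gr y)" for y
    using on_dom[OF True] on_dom[of y] off_dom[of y]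
    by (cases "y \<in> G") (metis ereal_less_eq(3) plus_ereal.simps(1), simp)
  then show ?thesis using True by (auto simp: convex_subdifferential_def)
next
  case False
  obtain y where "y \<in> G" using dom_nonempty by auto
  then have "\<not> (g x + ereal (v \<bullet> (y - x)) \<le> g y)"
    using off_dom[OF False] on_dom[of y] by (metis ereal_infty_less_eq(1) plus_ereal.simps(2) PInfty_neq_ereal(1))
  then show ?thesis using False by (auto simp: convex_subdifferential_def)
qed

lemma continuous_on_dom: "continuous_on G gr"
proof (clarsimp simp: continuous_on_eq_continuous_within)
  fix x assume "x \<in> G"
  then obtain r L where r: "r > 0" "L-lipschitz_on (ball x r \<inter> G) gr"
    using lip unfolding locally_lipschitz_on_def by blast
  then have "continuous (at x within ball x r \<inter> G) gr"
    using \<open>x \<in> G\<close> lipschitz_on_continuous_within by (metis IntI centre_in_ball)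
  moreover have "at x within ball x r \<inter> G = at x within G"
    using r(1) by (intro at_within_nhd[of x "ball x r"]) auto
  ultimately show "continuous (at x within G) gr" by simp
qed

text \<open>A closed domain keeps the limit point in \<open>G\<close>, and continuity of
  \<open>gr\<close> relative to \<open>G\<close> allows passing to the limit in the subgradient
  inequality, tested against a fixed \<open>y\<close>.\<close>

lemma closed_graph_subdifferential: "closed {(x, v). v \<in> convex_subdifferential g x}"
proof (clarsimp simp: closed_sequential_limits)
  fix z :: "nat \<Rightarrow> 'a \<times> 'a" and x v
  assume mem: "\<forall>n. case z n of (x, v) \<Rightarrow> v \<in> convex_subdifferential g x" and lim: "z \<longlonglongrightarrow> (x, v)"
  have sub: "snd (z n) \<in> convex_subdifferential g (fst (z n))" for n
    using mem by (simp add: case_prod_unfold)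
  have lx: "(\<lambda>n. fst (z n)) \<longlonglongrightarrow> x" and lv: "(\<lambda>n. snd (z n)) \<longlonglongrightarrow> v"
    using tendsto_fst[OF lim] tendsto_snd[OF lim] by auto
  have dom: "fst (z n) \<in> G" for n using sub[of n] by (simp add: subdifferential_iff)
  then have "x \<in> G" using closed_sequentially[OF closed _ lx] by blast
  have lg: "(\<lambda>n. gr (fst (z n))) \<longlonglongrightarrow> gr x"
    using continuous_on_dom dom lx \<open>x \<in> G\<close> unfolding continuous_on_sequentially by (auto simp: o_def)
  have "gr x + v \<bullet> (y - x) \<le> gr y" if "y \<in> G" for y
  proof (rule LIMSEQ_le_const2)
    show "(\<lambda>n. gr (fst (z n)) + snd (z n) \<bullet> (y - fst (z n))) \<longlonglongrightarrow> gr x + v \<bullet> (y - x)"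
      by (intro tendsto_intros lg lx lv)
    show "\<exists>m. \<forall>n\<ge>m. gr (fst (z n)) + snd (z n) \<bullet> (y - fst (z n)) \<le> gr y"
      using sub that by (auto simp: subdifferential_iff)
  qed
  then show "v \<in> convex_subdifferential g x" using \<open>x \<in> G\<close> by (simp add: subdifferential_iff)
qed

lemma subdifferential_closed: "closed (convex_subdifferential g x)"
proof -
  have "convex_subdifferential g x = (\<lambda>v. (x, v)) -` {(x, v). v \<in> convex_subdifferential g x}"
    by auto
  moreover have "closed ((\<lambda>v. (x, v)) -` {(x, v). v \<in> convex_subdifferential g x})"
    by (intro closed_vimage closed_graph_subdifferential continuous_intros)
  ultimately show ?thesis by simp
qed

lemma subdifferential_convex: "convex (convex_subdifferential g x)"
proof (rule convexI)
  fix v w and s t :: real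
  assume v: "v \<in> convex_subdifferential g x" and w: "w \<in> convex_subdifferential g x"
    and st: "0 \<le> s" "0 \<le> t" "s + t = 1"
  have "gr x + (s *\<^sub>R v + t *\<^sub>R w) \<bullet> (y - x) \<le> gr y" if "y \<in> G" for y
  proof -
    have "s * (gr x + v \<bullet> (y - x)) + t * (gr x + w \<bullet> (y - x)) \<le> gr y"
      using v w st that by (intro convex_bound_le) (auto simp: subdifferential_iff)
    moreover have "s * gr x + t * gr x = gr x" using st by (metis distrib_right mult_1)
    ultimately show ?thesis by (simp add: inner_left_distrib algebra_simps)
  qed
  then show "s *\<^sub>R v + t *\<^sub>R w \<in> convex_subdifferential g x"
    using v by (auto simp: subdifferential_iff)
qed

text \<open>Convexity makes a local Lipschitz bound near a point a global lower bound on the slopes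
  from that point.\<close>

lemma lower_slope_uniform:
  assumes "compact K" "K \<subseteq> G"
  shows "\<exists>L\<ge>0. \<forall>x\<in>K. \<forall>y\<in>G. gr x - L * norm (y - x) \<le> gr y"
proof (rule compact_uniform_bound[OF \<open>compact K\<close>])
  fix x assume "x \<in> K"
  then obtain r L where r: "r > 0" and L: "L-lipschitz_on (ball x r \<inter> G) gr"
    using lip assms unfolding locally_lipschitz_on_def by blast
  have "gr u - L * norm (y - u) \<le> gr y" if u: "u \<in> ball x (r / 2)" "u \<in> G" and y: "y \<in> G" for u y
  proof (cases "y = u")
    case False
    define d where "d = norm (y - u)"
    \<comment> \<open>Shortens the segment from \<open>u\<close> to \<open>y\<close> to length at
      most \<open>r / 4\<close>, so that its end point \<open>q\<close> remains in
      \<open>ball x r\<close>, where the Lipschitz bound applies. Convexity then transfers the slope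
      of the short piece to the whole segment.\<close>
    define s where "s = min 1 (r / 4 / d)"
    have d: "d > 0" using False by (simp add: d_def)
    have s: "0 < s" "s \<le> 1" "s * d \<le> r / 4"
      using d r by (auto simp: s_def min_def field_simps)
    define q where "q = u + s *\<^sub>R (y - u)"
    have q: "q \<in> G" "gr q \<le> gr u + s * (gr y - gr u)"
      using convex_combination[of u y s] u y s by (auto simp: q_def)
    have qu: "dist q u = s * d" using s by (simp add: q_def d_def dist_norm)
    have "dist x q \<le> dist x u + dist q u" by (metis dist_commute dist_triangle)
    then have "q \<in> ball x r" "u \<in> ball x r" using qu s u r by auto
    then have "\<bar>gr q - gr u\<bar> \<le> L * (s * d)"
      using lipschitz_onD[OF L, of q u] q u qu by (simp add: dist_real_def)
    then have "s * (gr u - L * d) \<le> s * gr y"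
      using q by (simp add: algebra_simps)
    then show ?thesis using s by (simp add: d_def)
  qed simp
  then show "\<exists>U L. open U \<and> x \<in> U \<and> (\<forall>u\<in>U \<inter> K. \<forall>y\<in>G. gr u - L * norm (y - u) \<le> gr y)"
    using r assms by (intro exI[of _ "ball x (r / 2)"] exI[of _ L]) auto
next
  fix L L' :: real and u
  assume "\<forall>y\<in>G. gr u - L * norm (y - u) \<le> gr y" "L \<le> L'"
  then show "\<forall>y\<in>G. gr u - L' * norm (y - u) \<le> gr y"
    by (smt (verit) mult_right_mono norm_ge_zero)
qed

lemma prox_iff:
  assumes "0 < \<alpha>"
  shows "u \<in> prox (\<lambda>y. ereal \<alpha> * g y) z \<longleftrightarrow>
    u \<in> G \<and> (\<forall>y\<in>G. \<alpha> * gr u + (norm (u - z))\<^sup>2 / 2 \<le> \<alpha> * gr y + (norm (y - z))\<^sup>2 / 2)"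
proof -
  define h where "h = (\<lambda>y. ereal \<alpha> * g y + ereal ((norm (y - z))\<^sup>2 / 2))"
  have h1: "h y = ereal (\<alpha> * gr y + (norm (y - z))\<^sup>2 / 2)" if "y \<in> G" for y
    unfolding h_def by (subst on_dom[OF that]) simp
  have h2: "h y = \<infinity>" if "y \<notin> G" for y
    unfolding h_def using assms by (simp add: off_dom[OF that])
  obtain y0 where y0: "y0 \<in> G" using dom_nonempty by blast
  have "u \<in> prox (\<lambda>y. ereal \<alpha> * g y) z \<longleftrightarrow> (\<forall>y. h u \<le> h y)"
    by (auto simp: prox_def is_arg_min_def h_def not_less)
  also have "\<dots> \<longleftrightarrow> u \<in> G \<and> (\<forall>y\<in>G. h u \<le> h y)"
    using h1 h2 y0 by (metis ereal_infty_less_eq(1) PInfty_neq_ereal(1) ereal_less_eq(1))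
  finally show ?thesis using h1 by auto
qed

text \<open>First-order optimality along the segment from \<open>u\<close> to \<open>y\<close>.
  After division by \<open>s\<close>, the change of the objective is at most
  \<open>Q + s * R\<close>, where \<open>R\<close> is the quadratic remainder; optimality makes this
  nonnegative for all small \<open>s\<close>, hence \<open>0 \<le> Q\<close>, which is the
  subgradient inequality multiplied by \<alpha>.\<close>

lemma prox_subgradient:
  assumes "0 < \<alpha>" and u: "u \<in> prox (\<lambda>y. ereal \<alpha> * g y) z"
  shows "u \<in> G" and "(1 / \<alpha>) *\<^sub>R (z - u) \<in> convex_subdifferential g u"
proof -
  have opt: "\<alpha> * gr u + (norm (u - z))\<^sup>2 / 2 \<le> \<alpha> * gr y + (norm (y - z))\<^sup>2 / 2" if "y \<in> G" for y
    using u that by (simp add: prox_iff[OF \<open>0 < \<alpha>\<close>])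
  show "u \<in> G" using u by (simp add: prox_iff[OF \<open>0 < \<alpha>\<close>])
  have "gr u + (1 / \<alpha>) *\<^sub>R (z - u) \<bullet> (y - u) \<le> gr y" if y: "y \<in> G" for y
  proof -
    define Q where "Q = \<alpha> * (gr y - gr u) + (u - z) \<bullet> (y - u)"
    define R where "R = (norm (y - u))\<^sup>2 / 2"
    have QR: "0 \<le> Q + s * R" if s: "0 < s" "s \<le> 1" for s
    proof -
      define q where "q = u + s *\<^sub>R (y - u)"
      have q: "q \<in> G" "gr q \<le> gr u + s * (gr y - gr u)"
        using convex_combination[of u y s] \<open>u \<in> G\<close> y s by (auto simp: q_def)
      have aux: "0 \<le> Y + F / 2" if "A + B / 2 \<le> C + E / 2" "E = B + F" "C \<le> A + Y"
        for A B C E F Y :: real using that by linarith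
      have nq: "(norm (q - z))\<^sup>2 = (norm (u - z))\<^sup>2 + (2 * s * ((u - z) \<bullet> (y - u)) + s\<^sup>2 * (norm (y - u))\<^sup>2)"
        unfolding power2_norm_eq_inner q_def
        by (simp add: inner_simps inner_commute power2_eq_square algebra_simps)
      have "\<alpha> * gr q \<le> \<alpha> * gr u + s * (\<alpha> * (gr y - gr u))"
        using mult_left_mono[OF q(2), of \<alpha>] \<open>0 < \<alpha>\<close> by (simp add: algebra_simps)
      then have "0 \<le> s * (\<alpha> * (gr y - gr u)) + (2 * s * ((u - z) \<bullet> (y - u)) + s\<^sup>2 * (norm (y - u))\<^sup>2) / 2"
        by (rule aux[OF opt[OF q(1)] nq])
      also have "\<dots> = s * (Q + s * R)"
        by (simp add: Q_def R_def power2_eq_square distrib_left add_divide_distrib)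
      finally show ?thesis using s by (simp add: zero_le_mult_iff)
    qed
    have "0 \<le> Q"
    proof (rule ccontr)
      assume "\<not> 0 \<le> Q"
      \<comment> \<open>This choice gives \<open>Q + s * R \<le> - s\<close>, which is
        negative.\<close>
      define s where "s = min 1 (- Q / (R + 1))"
      have R: "0 \<le> R" by (simp add: R_def)
      have s: "0 < s" "s \<le> 1" using \<open>\<not> 0 \<le> Q\<close> R by (auto simp: s_def divide_neg_pos)
      have "s * (R + 1) \<le> - Q"
        using R by (simp add: s_def pos_le_divide_eq[symmetric])
      then show False using QR[OF s] s by (simp add: algebra_simps)
    qed
    then have "(z - u) \<bullet> (y - u) \<le> \<alpha> * (gr y - gr u)"
      by (simp add: Q_def inner_diff_left)
    then have "((z - u) \<bullet> (y - u)) / \<alpha> \<le> gr y - gr u"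
      using \<open>0 < \<alpha>\<close> by (simp only: pos_divide_le_eq mult.commute)
    then show ?thesis unfolding inner_scaleR_left by simp
  qed
  then show "(1 / \<alpha>) *\<^sub>R (z - u) \<in> convex_subdifferential g u"
    using \<open>u \<in> G\<close> by (simp add: subdifferential_iff)
qed

text \<open>Allows a run to be continued artificially when its step sizes sum to less than the
  horizon. Minimizers are sought on a ball, outside of which the quadratic term beats the at most
  linear decrease of \<open>gr\<close>.\<close>

lemma prox_nonempty:
  assumes "0 < \<alpha>"
  shows "prox (\<lambda>y. ereal \<alpha> * g y) z \<noteq> {}"
proof -
  obtain x where x: "x \<in> G" using dom_nonempty by blast
  then obtain L where L: "0 \<le> L" "\<And>y. y \<in> G \<Longrightarrow> gr x - L * norm (y - x) \<le> gr y"
    using lower_slope_uniform[of "{x}"] by auto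
  define a where "a = \<alpha> * L"
  define c where "c = norm (x - z)"
  define h where "h = (\<lambda>y. \<alpha> * gr y + (norm (y - z))\<^sup>2 / 2)"
  \<comment> \<open>For \<open>q = norm (y - z)\<close> the comparison \<open>h x \<le> h y\<close>
    follows from \<open>0 \<le> (q + c) * (q - c - 2 * a)\<close>, which explains the
    radius.\<close>
  define B where "B = G \<inter> cball z (c + 2 * a)"
  have a: "0 \<le> a" using L \<open>0 < \<alpha>\<close> by (simp add: a_def)
  have "compact B" unfolding B_def using closed by (simp add: closed_Int_compact)
  moreover have xB: "x \<in> B" using x a by (simp add: B_def c_def dist_norm norm_minus_commute)
  moreover have "continuous_on B h"
    unfolding h_def B_def
    by (intro continuous_intros continuous_on_subset[OF continuous_on_dom]) auto
  ultimately obtain u where u: "u \<in> B" "\<And>y. y \<in> B \<Longrightarrow> h u \<le> h y"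
    using continuous_attains_inf[of B h] by blast
  have "h u \<le> h y" if y: "y \<in> G" for y
  proof (cases "y \<in> B")
    case False
    define q where "q = norm (y - z)"
    have q: "c + 2 * a < q" using False y by (simp add: B_def q_def dist_norm norm_minus_commute)
    have "norm (y - x) \<le> q + c"
      unfolding q_def c_def by (metis norm_triangle_ineq4 diff_diff_eq2 diff_add_cancel add_diff_cancel)
    then have "L * norm (y - x) \<le> L * (q + c)" using L by (intro mult_left_mono) auto
    then have "gr x - L * (q + c) \<le> gr y" using L(2)[OF y] by simp
    then have "\<alpha> * (gr x - L * (q + c)) \<le> \<alpha> * gr y" using \<open>0 < \<alpha>\<close> by (intro mult_left_mono) auto
    then have "\<alpha> * gr x - a * (q + c) \<le> \<alpha> * gr y" by (simp add: a_def algebra_simps)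
    moreover have "0 \<le> (q + c) * (q - c - 2 * a)"
      using q a by (intro mult_nonneg_nonneg) (auto simp: c_def q_def)
    then have "c\<^sup>2 / 2 \<le> q\<^sup>2 / 2 - a * (q + c)"
      by (simp add: power2_eq_square algebra_simps)
    ultimately have "h x \<le> h y" by (simp add: h_def q_def c_def)
    then show ?thesis using u(2)[OF xB] by simp
  qed (use u in auto)
  moreover have "u \<in> G" using u by (simp add: B_def)
  ultimately show ?thesis using prox_iff[OF assms, of u z] by (auto simp: h_def)
qed

text \<open>The subgradient produced by a proximal step is bounded even where the subdifferential is
  not (it contains the normal cone of the domain): test it against a point of the domain that is
  \<open>\<alpha> c\<close>-close to the prox center.\<close>

lemma prox_subgradient_bounded:
  assumes "0 < \<alpha>" and u: "u \<in> prox (\<lambda>y. ereal \<alpha> * g y) z"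
    and x: "x \<in> G" "norm (x - z) \<le> \<alpha> * c" and "0 \<le> L"
    and L: "\<And>y. y \<in> G \<Longrightarrow> gr x - L * norm (y - x) \<le> gr y"
  shows "norm ((1 / \<alpha>) *\<^sub>R (z - u)) \<le> 2 * (L + c)"
proof -
  define w where "w = (1 / \<alpha>) *\<^sub>R (z - u)"
  have uG: "u \<in> G" and w: "w \<in> convex_subdifferential g u"
    using prox_subgradient[OF assms(1) u] unfolding w_def by blast+
  have zu: "z - u = \<alpha> *\<^sub>R w" using \<open>0 < \<alpha>\<close> by (simp add: w_def)
  have "0 \<le> \<alpha> * c" using x norm_ge_zero order_trans by blast
  then have c: "0 \<le> c" using \<open>0 < \<alpha>\<close> by (simp add: zero_le_mult_iff)
  have "w \<bullet> (x - u) \<le> L * norm (u - x)"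
  proof -
    have "gr u + w \<bullet> (x - u) \<le> gr x" using w x(1) unfolding subdifferential_iff by blast
    then show ?thesis using L[OF uG] by linarith
  qed
  moreover have xu: "x - u = (x - z) + \<alpha> *\<^sub>R w" by (simp flip: zu)
  moreover have "norm (u - x) \<le> \<alpha> * c + \<alpha> * norm w"
    unfolding norm_minus_commute[of u x] xu
    using x \<open>0 < \<alpha>\<close> norm_triangle_ineq[of "x - z" "\<alpha> *\<^sub>R w"] by simp
  then have "L * norm (u - x) \<le> L * (\<alpha> * c + \<alpha> * norm w)" using \<open>0 \<le> L\<close> by (intro mult_left_mono)
  moreover have "- (norm w * (\<alpha> * c)) \<le> w \<bullet> (x - z)"
  proof -
    have "\<bar>w \<bullet> (x - z)\<bar> \<le> norm w * norm (x - z)" by (rule Cauchy_Schwarz_ineq2)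
    also have "\<dots> \<le> norm w * (\<alpha> * c)" using x by (intro mult_left_mono) auto
    finally show ?thesis by linarith
  qed
  \<comment> \<open>Every term carries one factor \<alpha>, so after cancellation the quadratic
    inequality for \<open>norm w\<close> does not depend on the step size.\<close>
  ultimately have "\<alpha> * (norm w)\<^sup>2 \<le> L * (\<alpha> * c + \<alpha> * norm w) + norm w * (\<alpha> * c)"
    by (simp add: inner_add_right power2_norm_eq_inner)
  also have "\<dots> = \<alpha> * (L * c + (L + c) * norm w)" by (simp add: algebra_simps)
  finally have le: "(norm w)\<^sup>2 \<le> L * c + (L + c) * norm w" using \<open>0 < \<alpha>\<close> by simp
  have "norm w \<le> 2 * (L + c)"
  proof (rule ccontr)
    assume "\<not> norm w \<le> 2 * (L + c)"
    then have gt: "2 * (L + c) < norm w" by simp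
    have "L * c \<le> (L + c) * (L + c)" using \<open>0 \<le> L\<close> c by (simp add: algebra_simps)
    also have "\<dots> \<le> norm w * (L + c)" using gt \<open>0 \<le> L\<close> c by (intro mult_right_mono) auto
    finally have "(norm w)\<^sup>2 \<le> 2 * (L + c) * norm w" using le by (simp add: algebra_simps)
    moreover have "2 * (L + c) * norm w < norm w * norm w"
      using gt \<open>0 \<le> L\<close> c by (intro mult_strict_right_mono) auto
    ultimately show False by (simp add: power2_eq_square)
  qed
  then show ?thesis by (simp add: w_def)
qed

end

section \<open>Limits of Euler polygons\<close>

lemma has_vector_derivative_quotient:
  assumes "(f has_vector_derivative f') (at x within S)"
  shows "((\<lambda>y. (1 / (y - x)) *\<^sub>R (f y - f x)) \<longlongrightarrow> f') (at x within S)"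
proof -
  have lim: "((\<lambda>y. (1 / norm (y - x)) *\<^sub>R (f y - (f x + (y - x) *\<^sub>R f'))) \<longlongrightarrow> 0) (at x within S)"
    using assms by (simp add: has_vector_derivative_def has_derivative_within)
  have "norm ((1 / (y - x)) *\<^sub>R (f y - f x) - f') = norm ((1 / norm (y - x)) *\<^sub>R (f y - (f x + (y - x) *\<^sub>R f')))"
    if "y \<noteq> x" for y
  proof -
    have "(1 / (y - x)) *\<^sub>R (f y - f x) - f' = (1 / (y - x)) *\<^sub>R (f y - (f x + (y - x) *\<^sub>R f'))"
      using that by (simp add: scaleR_right_diff_distrib scaleR_right_distrib)
    then show ?thesis by simp
  qed
  then have "eventually (\<lambda>y. norm ((1 / (y - x)) *\<^sub>R (f y - f x) - f') \<le>
      norm ((1 / norm (y - x)) *\<^sub>R (f y - (f x + (y - x) *\<^sub>R f')))) (at x within S)"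
    by (simp add: eventually_at_filter)
  then have "((\<lambda>y. (1 / (y - x)) *\<^sub>R (f y - f x) - f') \<longlongrightarrow> 0) (at x within S)"
    by (rule Lim_null_comparison) (use tendsto_norm_zero[OF lim] in simp)
  then show ?thesis by (rule LIM_zero_cancel)
qed

text \<open>In the \<open>k\<close>-th summand the weight, the time spent in the \<open>k\<close>-th step up to time \<open>t\<close>, is written as
  a clamp. It is monotone in \<open>t\<close> and the weights add up to \<open>t\<close>, hence difference quotients are convex
  combinations of the velocities.\<close>

definition polygon :: "(nat \<Rightarrow> real) \<Rightarrow> (nat \<Rightarrow> 'a::real_vector) \<Rightarrow> nat \<Rightarrow> real \<Rightarrow> 'a" where
  "polygon a y K t = y 0 +
    (\<Sum>k<K. (max 0 (min (t - sum a {..<k}) (a k)) / a k) *\<^sub>R (y (Suc k) - y k))"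

lemma sum_clamp:
  fixes a :: "nat \<Rightarrow> real"
  assumes "\<And>k. 0 < a k"
  shows "(\<Sum>k<K. max 0 (min (t - sum a {..<k}) (a k))) = max 0 (min t (sum a {..<K}))"
proof (induction K)
  case (Suc K)
  have "0 \<le> sum a {..<K}" using assms by (simp add: sum_nonneg less_imp_le)
  then show ?case using Suc assms[of K] by (auto simp: max_def min_def)
qed simp

lemma sum_lessThan_mono:
  fixes a :: "nat \<Rightarrow> real"
  assumes "\<And>k. 0 < a k" "m \<le> n"
  shows "sum a {..<m} \<le> sum a {..<n}"
  using assms by (intro sum_mono2) (auto simp: less_imp_le)

lemma polygon_vertex:
  assumes pos: "\<And>k. 0 < a k" and "m \<le> K"
  shows "polygon a y K (sum a {..<m}) = y m"
proof -
  have "(max 0 (min (sum a {..<m} - sum a {..<k}) (a k)) / a k) = (if k < m then 1 else 0)" for k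
  proof (cases "k < m")
    case True
    then have "sum a {..<Suc k} \<le> sum a {..<m}" by (intro sum_lessThan_mono[OF pos]) auto
    then show ?thesis using True pos[of k] by (simp add: min_def max_def)
  next
    case False
    then have "sum a {..<m} \<le> sum a {..<k}" by (intro sum_lessThan_mono[OF pos]) auto
    then show ?thesis using False pos[of k] by (simp add: min_def max_def)
  qed
  then have "polygon a y K (sum a {..<m}) = y 0 + (\<Sum>k<K. (if k < m then y (Suc k) - y k else 0))"
    unfolding polygon_def by (simp add: if_distrib[of "\<lambda>c. c *\<^sub>R _"] cong: if_cong)
  also have "(\<Sum>k<K. (if k < m then y (Suc k) - y k else 0)) = (\<Sum>k<m. y (Suc k) - y k)"
    using \<open>m \<le> K\<close> by (intro sum.mono_neutral_cong_right) auto
  finally show ?thesis by (simp add: sum_lessThan_telescope)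
qed

lemma polygon_diff:
  "polygon a y K t - polygon a y K s = (\<Sum>k<K. (max 0 (min (t - sum a {..<k}) (a k)) -
    max 0 (min (s - sum a {..<k}) (a k))) *\<^sub>R ((1 / a k) *\<^sub>R (y (Suc k) - y k)))"
  unfolding polygon_def
  by (simp add: diff_divide_distrib scaleR_left_diff_distrib sum_subtractf)

lemma polygon_lipschitz:
  fixes y :: "nat \<Rightarrow> 'a::real_normed_vector"
  assumes pos: "\<And>k. 0 < a k" and step: "\<And>k. norm (y (Suc k) - y k) \<le> C * a k"
  shows "C-lipschitz_on {0..} (polygon a y K)"
proof -
  have "0 \<le> C * a 0" using step[of 0] norm_ge_zero order_trans by blast
  then have C: "0 \<le> C" using pos[of 0] by (simp add: zero_le_mult_iff)
  have le: "norm (polygon a y K t - polygon a y K s) \<le> C * (t - s)" if st: "0 \<le> s" "s \<le> t" for s t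
  proof -
    let ?c = "\<lambda>k. max 0 (min (t - sum a {..<k}) (a k)) - max 0 (min (s - sum a {..<k}) (a k))"
    have "norm (polygon a y K t - polygon a y K s) \<le> (\<Sum>k<K. norm (?c k *\<^sub>R ((1 / a k) *\<^sub>R (y (Suc k) - y k))))"
      unfolding polygon_diff by (rule norm_sum)
    also have "\<dots> \<le> (\<Sum>k<K. ?c k * C)"
    proof (rule sum_mono)
      fix k
      have "0 \<le> ?c k" using st by (auto simp: max_def min_def)
      moreover have "norm ((1 / a k) *\<^sub>R (y (Suc k) - y k)) \<le> C"
        unfolding norm_scaleR using step[of k] pos[of k] by (simp add: pos_divide_le_eq mult.commute)
      ultimately show "norm (?c k *\<^sub>R ((1 / a k) *\<^sub>R (y (Suc k) - y k))) \<le> ?c k * C"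
        unfolding norm_scaleR[of "?c k"] by (simp only: abs_of_nonneg mult_left_mono)
    qed
    also have "\<dots> = C * (\<Sum>k<K. ?c k)" by (simp only: sum_distrib_left mult.commute)
    also have "(\<Sum>k<K. ?c k) = max 0 (min t (sum a {..<K})) - max 0 (min s (sum a {..<K}))"
      by (simp only: sum_subtractf sum_clamp[OF pos])
    also have "C * \<dots> \<le> C * (t - s)"
      using st C by (intro mult_left_mono) (auto simp: max_def min_def)
    finally show ?thesis .
  qed
  show ?thesis
  proof (rule lipschitz_onI[OF _ C])
    fix s t :: real assume "s \<in> {0..}" "t \<in> {0..}"
    then show "dist (polygon a y K s) (polygon a y K t) \<le> C * dist s t"
      using le[of s t] le[of t s] by (cases "s \<le> t") (auto simp: dist_norm norm_minus_commute)
  qed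
qed

lemma polygon_difference_quotient:
  assumes pos: "\<And>k. 0 < a k" and "convex E" and st: "0 \<le> s" "s < t" "t \<le> sum a {..<K}"
    and E: "\<And>k. k < K \<Longrightarrow> sum a {..<k} < t \<Longrightarrow> s < sum a {..<Suc k} \<Longrightarrow> (1 / a k) *\<^sub>R (y k - y (Suc k)) \<in> E"
  shows "(1 / (t - s)) *\<^sub>R (polygon a y K s - polygon a y K t) \<in> E"
proof -
  define c where "c = (\<lambda>k. max 0 (min (t - sum a {..<k}) (a k)) - max 0 (min (s - sum a {..<k}) (a k)))"
  \<comment> \<open>Zero weights are discarded because \<open>E\<close> is assumed to contain only
    the velocities of epochs that meet the interval between \<open>s\<close> and
    \<open>t\<close>.\<close>
  define I where "I = {k \<in> {..<K}. c k \<noteq> 0}"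
  have c0: "0 \<le> c k" for k using st by (auto simp: c_def max_def min_def)
  have "sum c {..<K} = max 0 (min t (sum a {..<K})) - max 0 (min s (sum a {..<K}))"
    unfolding c_def by (simp only: sum_subtractf sum_clamp[OF pos])
  also have "\<dots> = t - s" using st by (simp add: max_def min_def)
  finally have "sum c {..<K} = t - s" .
  moreover have "sum c {..<K} = sum c I"
    by (rule sum.mono_neutral_right) (auto simp: I_def)
  ultimately have sumI: "sum c I = t - s" by simp
  have "polygon a y K t - polygon a y K s = (\<Sum>k<K. c k *\<^sub>R ((1 / a k) *\<^sub>R (y (Suc k) - y k)))"
    unfolding c_def by (rule polygon_diff)
  also have "\<dots> = (\<Sum>k\<in>I. c k *\<^sub>R ((1 / a k) *\<^sub>R (y (Suc k) - y k)))"
    by (rule sum.mono_neutral_right) (auto simp: I_def)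
  finally have "polygon a y K s - polygon a y K t = - (\<Sum>k\<in>I. c k *\<^sub>R ((1 / a k) *\<^sub>R (y (Suc k) - y k)))"
    by (simp add: algebra_simps)
  also have "\<dots> = (\<Sum>k\<in>I. c k *\<^sub>R ((1 / a k) *\<^sub>R (y k - y (Suc k))))"
    by (simp add: algebra_simps flip: sum_negf)
  finally have "(1 / (t - s)) *\<^sub>R (polygon a y K s - polygon a y K t)
    = (\<Sum>k\<in>I. (c k / (t - s)) *\<^sub>R ((1 / a k) *\<^sub>R (y k - y (Suc k))))"
    by (simp add: scaleR_sum_right)
  also have "\<dots> \<in> E"
  proof (rule convex_sum[OF _ \<open>convex E\<close>])
    show "finite I" by (simp add: I_def)
    show "(\<Sum>k\<in>I. c k / (t - s)) = 1" using sumI st by (simp flip: sum_divide_distrib)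
    fix k assume k: "k \<in> I"
    show "0 \<le> c k / (t - s)" using c0 st by simp
    have "sum a {..<k} < t" "s < sum a {..<Suc k}"
      using k pos[of k] st by (auto simp: I_def c_def max_def min_def split: if_splits)
    then show "(1 / a k) *\<^sub>R (y k - y (Suc k)) \<in> E" using E k by (simp add: I_def)
  qed
  finally show ?thesis .
qed

text \<open>The last conclusion is the closure of the inclusion under limits, stated at one time
  \<open>t\<close> with a fixed set \<open>E\<close> in the role of the right-hand side at
  \<open>x t\<close>. This makes it applicable exactly at those times where the limit lies in the
  ball in which epochs are controlled. The radius \<delta> must be independent of \<open>j\<close>
  and \<open>k\<close>; \<open>t < T\<close> leaves room for difference quotients to the right of
  \<open>t\<close>.\<close>

lemma euler_polygons_limit:
  fixes Y :: "nat \<Rightarrow> nat \<Rightarrow> 'a::euclidean_space" and a :: "nat \<Rightarrow> nat \<Rightarrow> real"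
  assumes pos: "\<And>j k. 0 < a j k" and small: "\<And>j k. a j k \<le> A j" "A \<longlonglongrightarrow> 0"
    and step: "\<And>j k. norm (Y j (Suc k) - Y j k) \<le> C * a j k"
    and X0: "compact X0" "\<And>j. Y j 0 \<in> X0"
    and "0 < T" and long: "\<And>j. \<exists>K. T \<le> sum (a j) {..<K}"
  obtains x r where "strict_mono (r :: nat \<Rightarrow> nat)" "C-lipschitz_on {0..T} x" "x 0 \<in> X0"
    and "\<And>e. 0 < e \<Longrightarrow> \<exists>n. \<forall>j\<ge>n. \<forall>k. sum (a (r j)) {..<k} \<le> T \<longrightarrow>
      norm (Y (r j) k - x (sum (a (r j)) {..<k})) < e"
    and "\<And>t. t \<in> {0..T} \<Longrightarrow> \<exists>k. (\<lambda>j. Y (r j) (k j)) \<longlonglongrightarrow> x t"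
    and "\<And>t x' E. \<lbrakk>0 \<le> t; t < T; (x has_vector_derivative x') (at t within {0..T}); convex E; closed E;
      \<And>\<eta>. 0 < \<eta> \<Longrightarrow> \<exists>\<delta>>0. \<forall>j k. norm (Y j k - x t) < \<delta> \<and> a j k < \<delta> \<longrightarrow>
        (\<exists>d\<in>E. norm ((1 / a j k) *\<^sub>R (Y j k - Y j (Suc k)) - d) \<le> \<eta>)\<rbrakk> \<Longrightarrow> - x' \<in> E"
proof -
  obtain K where K: "\<And>j. T \<le> sum (a j) {..<K j}" using long by metis
  define F where "F = (\<lambda>j. polygon (a j) (Y j) (K j))"
  have Flip: "C-lipschitz_on {0..} (F j)" for j
    unfolding F_def using pos step by (intro polygon_lipschitz)
  have C: "0 \<le> C" using lipschitz_on_nonneg[OF Flip] .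
  have Fv: "F j (sum (a j) {..<k}) = Y j k" if "k \<le> K j" for j k
    unfolding F_def using pos that by (intro polygon_vertex)
  have leK: "k \<le> K j" if "sum (a j) {..<k} \<le> T" for j k
  proof (rule ccontr)
    assume "\<not> k \<le> K j"
    then have "sum (a j) {..<Suc (K j)} \<le> sum (a j) {..<k}"
      by (intro sum_lessThan_mono[OF pos]) auto
    then show False using that K[of j] pos[of j "K j"] by simp
  qed
  obtain B where B: "\<And>y. y \<in> X0 \<Longrightarrow> norm y \<le> B"
    using compact_imp_bounded[OF X0(1)] by (auto simp: bounded_iff)
  have F0: "F j 0 = Y j 0" for j using Fv[of 0 j] by simp
  have FC: "norm (F j s - F j t) \<le> C * \<bar>s - t\<bar>" if "0 \<le> s" "0 \<le> t" for j s t
    using lipschitz_onD[OF Flip, of s t j] that by (simp add: dist_norm)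
  have bound: "norm (F j t) \<le> B + C * T" if "t \<in> {0..T}" for j t
  proof -
    have "norm (F j t - F j 0) \<le> C * t" using FC[of t 0 j] that by simp
    also have "\<dots> \<le> C * T" using that C by (intro mult_left_mono) auto
    finally show ?thesis
      using norm_triangle_sub[of "F j t" "F j 0"] B[OF X0(2)[of j]] by (simp add: F0)
  qed
  have equi: "\<exists>d. 0 < d \<and> (\<forall>j s. s \<in> {0..T} \<and> norm (t - s) < d \<longrightarrow> norm (F j t - F j s) < e)"
    if "t \<in> {0..T}" "0 < e" for t e
  proof (intro exI[of _ "e / (C + 1)"] conjI allI impI)
    show "0 < e / (C + 1)" using that C by simp
    fix j s assume s: "s \<in> {0..T} \<and> norm (t - s) < e / (C + 1)"
    have "norm (F j t - F j s) \<le> C * \<bar>t - s\<bar>" using FC[of t s j] that s by simp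
    also have "\<dots> \<le> (C + 1) * \<bar>t - s\<bar>" by (simp add: algebra_simps)
    also have "\<dots> < e" using s C by (simp add: field_simps)
    finally show "norm (F j t - F j s) < e" .
  qed
  obtain x r where r: "strict_mono (r :: nat \<Rightarrow> nat)"
    and unif: "\<And>e. 0 < e \<Longrightarrow> \<exists>n. \<forall>j t. j \<ge> n \<and> t \<in> {0..T} \<longrightarrow> norm (F (r j) t - x t) < e"
    using Arzela_Ascoli[OF compact_Icc bound equi] by metis
  have lim: "(\<lambda>j. F (r j) t) \<longlonglongrightarrow> x t" if "t \<in> {0..T}" for t
  proof (rule LIMSEQ_I)
    fix e :: real assume "0 < e"
    then show "\<exists>n. \<forall>j\<ge>n. norm (F (r j) t - x t) < e" using unif[of e] that by blast
  qed
  have Ar: "(\<lambda>j. A (r j)) \<longlonglongrightarrow> 0" using LIMSEQ_subseq_LIMSEQ[OF small(2) r] by (simp add: o_def)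
  have xlip: "C-lipschitz_on {0..T} x"
  proof (rule lipschitz_onI[OF _ C])
    fix s t assume st: "s \<in> {0..T}" "t \<in> {0..T}"
    show "dist (x s) (x t) \<le> C * dist s t"
    proof (rule LIMSEQ_le_const2)
      show "(\<lambda>j. dist (F (r j) s) (F (r j) t)) \<longlonglongrightarrow> dist (x s) (x t)"
        using st by (intro tendsto_dist lim)
      show "\<exists>n. \<forall>j\<ge>n. dist (F (r j) s) (F (r j) t) \<le> C * dist s t"
        using FC st by (auto simp: dist_norm)
    qed
  qed
  show thesis
  proof (rule that[OF r xlip])
    have "(\<lambda>j. Y (r j) 0) \<longlonglongrightarrow> x 0" using lim[of 0] \<open>0 < T\<close> by (simp add: F0)
    then show "x 0 \<in> X0"
      by (rule closed_sequentially[OF compact_imp_closed[OF X0(1)] X0(2)])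
  next
    fix e :: real assume "0 < e"
    then obtain n where n: "\<And>j t. j \<ge> n \<Longrightarrow> t \<in> {0..T} \<Longrightarrow> norm (F (r j) t - x t) < e"
      using unif by blast
    show "\<exists>n. \<forall>j\<ge>n. \<forall>k. sum (a (r j)) {..<k} \<le> T \<longrightarrow> norm (Y (r j) k - x (sum (a (r j)) {..<k})) < e"
    proof (intro exI[of _ n] allI impI)
      fix j k assume "n \<le> j" "sum (a (r j)) {..<k} \<le> T"
      moreover have "0 \<le> sum (a (r j)) {..<k}" using pos by (simp add: sum_nonneg less_imp_le)
      ultimately show "norm (Y (r j) k - x (sum (a (r j)) {..<k})) < e"
        using n[of j "sum (a (r j)) {..<k}"] Fv[of k "r j"] leK[where j="r j" and k=k] by simp
    qed
  next
    fix t assume t: "t \<in> {0..T}"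
    \<comment> \<open>The first vertex at or after time \<open>t\<close>, which overshoots
      \<open>t\<close> by at most one step. Hence \<open>x t\<close> is a limit of iterates
      themselves, and so inherits any closed constraint that they satisfy.\<close>
    define k where "k = (\<lambda>j. LEAST k. t \<le> sum (a (r j)) {..<k})"
    have near: "norm (Y (r j) (k j) - F (r j) t) \<le> C * A (r j)" for j
    proof -
      let ?s = "\<lambda>k. sum (a (r j)) {..<k}"
      have tK: "t \<le> ?s (K (r j))" using t K[of "r j"] by simp
      have le: "k j \<le> K (r j)" unfolding k_def by (rule Least_le[of "\<lambda>k. t \<le> ?s k", OF tK])
      have ge: "t \<le> ?s (k j)" unfolding k_def by (rule LeastI[of "\<lambda>k. t \<le> ?s k", OF tK])
      have "?s (k j) - t \<le> A (r j)"
      proof (cases "k j")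
        case 0
        then show ?thesis using t small(1)[of "r j" 0] pos[of "r j" 0] by simp
      next
        case (Suc m)
        then have "\<not> t \<le> ?s m" unfolding k_def using not_less_Least by (metis lessI)
        then show ?thesis using Suc small(1)[of "r j" m] by simp
      qed
      then have "C * \<bar>?s (k j) - t\<bar> \<le> C * A (r j)" using C ge by (intro mult_left_mono) auto
      then show ?thesis using FC[of "?s (k j)" t "r j"] ge t Fv[OF le] by simp
    qed
    have "(\<lambda>j. Y (r j) (k j) - F (r j) t) \<longlonglongrightarrow> 0"
      using near by (intro Lim_null_comparison[OF _ tendsto_mult_right_zero[OF Ar, of C]]) (auto simp: eventually_sequentially)
    then have "(\<lambda>j. Y (r j) (k j)) \<longlonglongrightarrow> x t"
      using tendsto_add[OF _ lim[OF t]] by fastforce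
    then show "\<exists>k. (\<lambda>j. Y (r j) (k j)) \<longlonglongrightarrow> x t" by blast
  next
    fix t x' E
    assume t: "0 \<le> t" "t < T" and der: "(x has_vector_derivative x') (at t within {0..T})"
      and E: "convex E" "closed E"
      and near: "\<And>\<eta>. 0 < \<eta> \<Longrightarrow> \<exists>\<delta>>0. \<forall>j k. norm (Y j k - x t) < \<delta> \<and> a j k < \<delta> \<longrightarrow>
        (\<exists>d\<in>E. norm ((1 / a j k) *\<^sub>R (Y j k - Y j (Suc k)) - d) \<le> \<eta>)"
    \<comment> \<open>Nearby velocities are only \<eta>-close to \<open>E\<close>, so averages are
      taken in the closed convex thickening of \<open>E\<close> by a ball of radius \<eta>, which is
      shrunk at the end.\<close>
    have main: "- x' \<in> E + cball 0 \<eta>" if "0 < \<eta>" for \<eta>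
    proof -
      obtain \<delta> where \<delta>: "\<delta> > 0" "\<And>j k. norm (Y j k - x t) < \<delta> \<Longrightarrow> a j k < \<delta> \<Longrightarrow>
        \<exists>d\<in>E. norm ((1 / a j k) *\<^sub>R (Y j k - Y j (Suc k)) - d) \<le> \<eta>"
        using near[OF \<open>0 < \<eta>\<close>] by blast
      have E': "convex (E + cball 0 \<eta>)" "closed (E + cball 0 \<eta>)"
        using E by (auto intro: convex_set_plus closed_compact_set_plus)
      \<comment> \<open>Half of \<delta> is spent on the motion of the limit curve during a time
        \<open>h\<close>, the other half on the uniform error of the polygons; \<open>h\<close> also
        bounds the step sizes by \<delta>.\<close>
      define h where "h = \<delta> / (4 * (C + 1))"
      have h: "0 < h" "C * h < \<delta> / 2" "h < \<delta>"
        using \<delta>(1) C by (auto simp: h_def field_simps add_pos_nonneg)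
      have quot: "(1 / (s - t)) *\<^sub>R (x t - x s) \<in> E + cball 0 \<eta>" if s: "t < s" "s < t + h" "s \<le> T" for s
      proof -
        have ev: "eventually (\<lambda>j. (1 / (s - t)) *\<^sub>R (F (r j) t - F (r j) s) \<in> E + cball 0 \<eta>) sequentially"
        proof -
          obtain n where n: "\<And>j u. j \<ge> n \<Longrightarrow> u \<in> {0..T} \<Longrightarrow> norm (F (r j) u - x u) < \<delta> / 2"
            using unif[of "\<delta> / 2"] \<delta>(1) by auto
          have "eventually (\<lambda>j. A (r j) < h) sequentially"
            using order_tendstoD(2)[OF Ar h(1)] .
          moreover have "eventually (\<lambda>j. n \<le> j) sequentially" by (rule eventually_ge_at_top)
          ultimately show ?thesis
          proof eventually_elim
            case (elim j)
            show ?case unfolding F_def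
            proof (rule polygon_difference_quotient[OF pos E'(1)])
              show "0 \<le> t" "t < s" "s \<le> sum (a (r j)) {..<K (r j)}" using t s K[of "r j"] by auto
              fix k assume k: "k < K (r j)" "sum (a (r j)) {..<k} < s" "t < sum (a (r j)) {..<Suc k}"
              \<comment> \<open>The start time of the epoch. It may precede \<open>t\<close>, but by
                less than the length of this one step, hence by less than \<open>h\<close>.\<close>
              define u where "u = sum (a (r j)) {..<k}"
              have u0: "0 \<le> u" unfolding u_def using pos by (simp add: sum_nonneg less_imp_le)
              have uT: "u \<in> {0..T}" using u0 k s by (simp add: u_def)
              have ah: "a (r j) k < h" using small(1)[of "r j" k] elim by simp
              have "\<bar>u - t\<bar> \<le> h" using k s ah by (simp add: u_def)
              then have "C * \<bar>u - t\<bar> < \<delta> / 2" using C h(2) by (meson le_less_trans mult_left_mono)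
              then have "norm (x u - x t) < \<delta> / 2"
                using lipschitz_onD[OF xlip, of u t] uT t by (simp add: dist_norm)
              moreover have "norm (Y (r j) k - x u) < \<delta> / 2"
                using n[of j u] elim uT Fv[of k "r j"] k by (simp add: u_def)
              ultimately have "norm (Y (r j) k - x t) < \<delta>"
                using norm_triangle_ineq[of "Y (r j) k - x u" "x u - x t"] by simp
              then obtain d where d: "d \<in> E" "norm ((1 / a (r j) k) *\<^sub>R (Y (r j) k - Y (r j) (Suc k)) - d) \<le> \<eta>"
                using \<delta>(2)[of "r j" k] ah h by fastforce
              have "d + ((1 / a (r j) k) *\<^sub>R (Y (r j) k - Y (r j) (Suc k)) - d) \<in> E + cball 0 \<eta>"
                using d by (intro set_plus_intro) auto
              then show "(1 / a (r j) k) *\<^sub>R (Y (r j) k - Y (r j) (Suc k)) \<in> E + cball 0 \<eta>" by simp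
            qed
          qed
        qed
        have "(\<lambda>j. (1 / (s - t)) *\<^sub>R (F (r j) t - F (r j) s)) \<longlonglongrightarrow> (1 / (s - t)) *\<^sub>R (x t - x s)"
          using t s by (intro tendsto_intros lim) auto
        then show ?thesis using Lim_in_closed_set[OF E'(2) ev] by simp
      qed
      have "((\<lambda>s. (1 / (s - t)) *\<^sub>R (x s - x t)) \<longlongrightarrow> x') (at t within {t..T})"
        by (rule has_vector_derivative_quotient[OF has_vector_derivative_within_subset[OF der]]) (use t in auto)
      then have "((\<lambda>s. - ((1 / (s - t)) *\<^sub>R (x s - x t))) \<longlongrightarrow> - x') (at t within {t..T})"
        by (rule tendsto_minus)
      moreover have "eventually (\<lambda>s. - ((1 / (s - t)) *\<^sub>R (x s - x t)) \<in> E + cball 0 \<eta>) (at t within {t..T})"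
        unfolding eventually_at
      proof (intro exI[of _ h] conjI ballI impI)
        fix s assume s: "s \<in> {t..T}" "s \<noteq> t \<and> dist s t < h"
        then have "t < s" "s < t + h" "s \<le> T" by (auto simp: dist_real_def)
        from quot[OF this] show "- ((1 / (s - t)) *\<^sub>R (x s - x t)) \<in> E + cball 0 \<eta>"
          by (simp add: scaleR_right_diff_distrib)
      qed (rule h)
      moreover have "at t within {t..T} \<noteq> bot"
        using t by (simp add: at_within_Icc_at_right)
      ultimately show ?thesis by (intro Lim_in_closed_set[OF E'(2)])
    qed
    show "- x' \<in> E"
    proof (rule closed_approachable[OF E(2), THEN iffD1, rule_format])
      fix e :: real assume "0 < e"
      then have "- x' \<in> E + cball 0 (e / 2)" by (intro main) simp
      then obtain d w where "d \<in> E" "w \<in> cball 0 (e / 2)" "- x' = d + w" by (auto elim: set_plus_elim)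
      then show "\<exists>y\<in>E. dist y (- x') < e" using \<open>0 < e\<close> by (auto simp: dist_norm intro!: bexI[of _ d])
    qed
  qed
qed

section \<open>Epochs of proximal random reshuffling\<close>

lemma locally_lipschitz_on_compact:
  assumes h: "locally_lipschitz_on S h" and K: "compact K" "K \<subseteq> S"
  shows "\<exists>L. L-lipschitz_on K h"
proof -
  \<comment> \<open>The function is viewed as a constant family over a single dummy time, for which
    the passage from local to global on compact sets is available.\<close>
  have "local_lipschitz {0::real} K (\<lambda>_. h)"
  proof (rule local_lipschitzI)
    fix t :: real and x assume "x \<in> K"
    then obtain r L where r: "0 < r" "L-lipschitz_on (ball x r \<inter> S) h"
      using h K unfolding locally_lipschitz_on_def by blast
    have "L-lipschitz_on (cball x (r / 2) \<inter> K) h"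
      using r K by (intro lipschitz_on_subset[OF r(2)]) auto
    then show "\<exists>u>0. \<exists>L. \<forall>t\<in>cball t u \<inter> {0::real}. L-lipschitz_on (cball x u \<inter> K) h"
      using r(1) by (intro exI[of _ "r / 2"]) auto
  qed
  from local_lipschitz_compact_implies_lipschitz[OF this K(1) compact_sing]
  show ?thesis by (metis continuous_on_const singletonI)
qed

lemma lipschitz_on_sum:
  fixes h :: "'i \<Rightarrow> 'a::metric_space \<Rightarrow> 'b::real_normed_vector"
  assumes "\<And>i. i \<in> I \<Longrightarrow> \<exists>L. L-lipschitz_on S (h i)"
  shows "\<exists>L. L-lipschitz_on S (\<lambda>x. \<Sum>i\<in>I. h i x)"
  using assms
proof (induction I rule: infinite_finite_induct)
  case (insert i I)
  then obtain L L' where "L-lipschitz_on S (h i)" "L'-lipschitz_on S (\<lambda>x. \<Sum>i\<in>I. h i x)"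
    by (meson insertI1 insertI2)
  then have "(L + L')-lipschitz_on S (\<lambda>x. h i x + (\<Sum>i\<in>I. h i x))"
    by (rule lipschitz_on_add)
  then show ?case using insert by auto
qed (auto intro: lipschitz_on_constant)

text \<open>One iteration as a relation, with permutation and inner iterates hidden, so that runs
  can be stopped or continued epoch by epoch.\<close>

definition prr_epoch ::
  "nat \<Rightarrow> (nat \<Rightarrow> 'a::euclidean_space \<Rightarrow> 'a set) \<Rightarrow> ('a \<Rightarrow> ereal) \<Rightarrow> real \<Rightarrow> 'a \<Rightarrow> 'a \<Rightarrow> bool" where
  "prr_epoch N D g \<alpha> x y \<longleftrightarrow>
    (\<exists>(\<sigma> :: nat \<Rightarrow> nat) (z :: nat \<Rightarrow> 'a). \<sigma> permutes {1..N} \<and> z 0 = x \<and>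
      (\<forall>i\<in>{1..N}. \<exists>v\<in>D (\<sigma> i) (z (i - 1)). z i = z (i - 1) - \<alpha> *\<^sub>R v) \<and>
      y \<in> prox (\<lambda>y. ereal \<alpha> * g y) (z N))"

lemma prr_sequence_epoch:
  "prr_sequence N f D g \<alpha> x \<Longrightarrow> prr_epoch N D g (\<alpha> k) (x k) (x (Suc k))"
  unfolding prr_sequence_def prr_epoch_def by metis

locale prr = closed_convex_lipschitz g for g :: "'a::euclidean_space \<Rightarrow> ereal" +
  fixes N :: nat and f :: "nat \<Rightarrow> 'a \<Rightarrow> real" and D :: "nat \<Rightarrow> 'a \<Rightarrow> 'a set" and m :: real
  assumes N: "1 \<le> N"
    and conservative: "\<And>i. i \<in> {1..N} \<Longrightarrow> conservative_field (f i) (D i)"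
    and bounded_D: "\<And>i. i \<in> {1..N} \<Longrightarrow> locally_bounded_map (D i)"
    and convex_D: "\<And>i x. i \<in> {1..N} \<Longrightarrow> convex (D i x)"
    and lower_bound: "\<And>x. ereal m \<le> objective N f g x"
begin

abbreviation "D\<^sub>\<Phi> \<equiv> objective_field N D g"
abbreviation "\<Phi> x \<equiv> (\<Sum>i=1..N. f i x) + gr x"

lemma eff_dom_objective: "eff_dom (objective N f g) = G"
proof -
  have "objective N f g x < \<infinity> \<longleftrightarrow> g x < \<infinity>" for x
    unfolding objective_def by (cases "g x") auto
  then show ?thesis by (auto simp: eff_dom_def)
qed

lemma lower_bound_dom: "x \<in> G \<Longrightarrow> m \<le> \<Phi> x"
  using lower_bound[of x] on_dom[of x] unfolding objective_def by (metis ereal_less_eq(3) plus_ereal.simps(1))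

lemma D_props:
  assumes "i \<in> {1..N}"
  shows "closed {(x, v). v \<in> D i x}" "D i x \<noteq> {}" "compact (D i x)" "locally_lipschitz_on UNIV (f i)"
  using conservative[OF assms] unfolding conservative_field_def by blast+

lemma convex_objective_field: "convex (D\<^sub>\<Phi> x)"
  unfolding objective_field_def
  by (intro convex_set_plus convex_set_sum convex_D subdifferential_convex)

text \<open>Only the subdifferential may be unbounded; the other summands form a compact set, and
  closed plus compact is closed.\<close>

lemma closed_objective_field: "closed (D\<^sub>\<Phi> x)"
proof -
  have "closed (convex_subdifferential g x + (\<Sum>i=1..N. D i x))"
    by (intro closed_compact_set_plus compact_set_sum subdifferential_closed D_props)
  then show ?thesis by (simp add: objective_field_def add.commute)
qed

lemma objective_field_iff:
  "d \<in> D\<^sub>\<Phi> x \<longleftrightarrow> (\<exists>v w. (\<forall>i\<in>{1..N}. v i \<in> D i x) \<and> w \<in> convex_subdifferential g x \<and>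
    d = (\<Sum>i=1..N. v i) + w)"
  unfolding objective_field_def set_plus_def by (auto simp: set_sum_alt)

lemma D_bounded_on_compact:
  assumes "compact K"
  shows "\<exists>M\<ge>0. \<forall>i\<in>{1..N}. \<forall>x\<in>K. \<forall>v\<in>D i x. norm v \<le> M"
proof -
  have "\<exists>M\<ge>0. \<forall>x\<in>K. \<forall>v\<in>D i x. norm v \<le> M" if i: "i \<in> {1..N}" for i
  proof (rule compact_uniform_bound[OF assms])
    fix x
    obtain U where U: "open U" "x \<in> U" "bounded (\<Union>y\<in>U. D i y)"
      using bounded_D[OF i] unfolding locally_bounded_map_def by blast
    then obtain M where "\<forall>v\<in>(\<Union>y\<in>U. D i y). norm v \<le> M" unfolding bounded_iff by blast
    then show "\<exists>U M. open U \<and> x \<in> U \<and> (\<forall>y\<in>U \<inter> K. \<forall>v\<in>D i y. norm v \<le> M)"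
      using U by (intro exI[of _ U] exI[of _ M]) auto
  qed (meson order_trans)
  then have "\<forall>i\<in>{1..N}. \<exists>M\<ge>0. \<forall>x\<in>K. \<forall>v\<in>D i x. norm v \<le> M" by blast
  then obtain M where M: "\<forall>i\<in>{1..N}. 0 \<le> M i \<and> (\<forall>x\<in>K. \<forall>v\<in>D i x. norm v \<le> M i)"
    by (rule bchoice[THEN exE])
  show ?thesis
  proof (intro exI[of _ "sum M {1..N}"] conjI ballI)
    show "0 \<le> sum M {1..N}" using M by (intro sum_nonneg) blast
    fix i x v assume "i \<in> {1..N}" "x \<in> K" "v \<in> D i x"
    then have "norm v \<le> M i" using M by blast
    also have "M i \<le> sum M {1..N}" using M \<open>i \<in> {1..N}\<close> by (intro member_le_sum) auto
    finally show "norm v \<le> sum M {1..N}" .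
  qed
qed

lemma prr_epoch_exists:
  assumes "0 < \<alpha>"
  shows "\<exists>y. prr_epoch N D g \<alpha> x y"
proof -
  have "\<forall>i\<in>{1..N}. \<forall>u. \<exists>v. v \<in> D i u" using D_props(2) by blast
  then obtain d where d: "\<And>i u. i \<in> {1..N} \<Longrightarrow> d i u \<in> D i u" by metis
  define z where "z = rec_nat x (\<lambda>i u. u - \<alpha> *\<^sub>R d (Suc i) u)"
  have z: "z 0 = x" "\<And>i. z (Suc i) = z i - \<alpha> *\<^sub>R d (Suc i) (z i)"
    by (simp_all add: z_def)
  obtain y where "y \<in> prox (\<lambda>y. ereal \<alpha> * g y) (z N)" using prox_nonempty[OF assms] by blast
  moreover have "\<exists>v\<in>D (id i) (z (i - 1)). z i = z (i - 1) - \<alpha> *\<^sub>R v" if "i \<in> {1..N}" for i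
    using z(2)[of "i - 1"] d[OF that] that by auto
  ultimately have "prr_epoch N D g \<alpha> x y"
    unfolding prr_epoch_def using z(1) permutes_id by blast
  then show ?thesis by blast
qed

lemma prr_epoch_dom: "prr_epoch N D g \<alpha> x y \<Longrightarrow> 0 < \<alpha> \<Longrightarrow> y \<in> G"
  unfolding prr_epoch_def using prox_subgradient(1) by blast

text \<open>Turns an epoch into one perturbed Euler step: the mean velocity is a sum of elements of
  the \<open>D i\<close> at points close to \<open>x\<close>, plus a subgradient of \<open>g\<close>
  at the end point \<open>y\<close>. The constants depend on \<open>R\<close> only, not on the
  permutation or the selections.\<close>

lemma prr_epoch_decomposition:
  "\<exists>\<alpha>\<^sub>0>0. \<exists>C\<ge>0. \<forall>\<alpha> x y. 0 < \<alpha> \<and> \<alpha> \<le> \<alpha>\<^sub>0 \<and> x \<in> G \<and> norm x \<le> R \<and> prr_epoch N D g \<alpha> x y \<longrightarrow>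
    norm (y - x) \<le> C * \<alpha> \<and>
    (\<exists>v p w. (\<forall>i\<in>{1..N}. v i \<in> D i (p i) \<and> norm (v i) \<le> C \<and> norm (p i - x) \<le> C * \<alpha>) \<and>
      w \<in> convex_subdifferential g y \<and> norm w \<le> C \<and> x - y = \<alpha> *\<^sub>R ((\<Sum>i=1..N. v i) + w))"
proof -
  obtain M where M: "0 \<le> M" "\<And>i x v. i \<in> {1..N} \<Longrightarrow> x \<in> cball 0 (R + 1) \<Longrightarrow> v \<in> D i x \<Longrightarrow> norm v \<le> M"
    using D_bounded_on_compact[of "cball 0 (R + 1)"] by auto
  have "compact (G \<inter> cball 0 R)" using closed by (simp add: closed_Int_compact)
  from lower_slope_uniform[OF this] obtain L
    where L: "0 \<le> L" "\<And>x y. x \<in> G \<inter> cball 0 R \<Longrightarrow> y \<in> G \<Longrightarrow> gr x - L * norm (y - x) \<le> gr y"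
    by auto
  \<comment> \<open>All \<open>N\<close> inner steps together move by at most
    \<open>\<alpha> * c\<close>. The threshold \<open>1 / (c + 1)\<close> makes this at most 1,
    which keeps the inner iterates in the ball of radius \<open>R + 1\<close> on which
    \<open>M\<close> bounds the \<open>D i\<close>.\<close>
  define c where "c = real N * M"
  define C where "C = M + c + 2 * (L + c)"
  have c: "0 \<le> c" using M by (simp add: c_def)
  have C: "0 \<le> C" "M \<le> C" "c \<le> C" "2 * (L + c) \<le> C" "c + 2 * (L + c) \<le> C"
    using M L c by (auto simp: C_def)
  show ?thesis
  proof (rule exI[of _ "1 / (c + 1)"], rule conjI[rotated], rule exI[of _ C], intro conjI allI impI)
    show "0 < 1 / (c + 1)" "0 \<le> C" using c C by auto
    fix \<alpha> x y
    assume asm: "0 < \<alpha> \<and> \<alpha> \<le> 1 / (c + 1) \<and> x \<in> G \<and> norm x \<le> R \<and> prr_epoch N D g \<alpha> x y"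
    then have \<alpha>: "0 < \<alpha>" and x: "x \<in> G" "norm x \<le> R" by auto
    have "\<alpha> * (c + 1) \<le> 1" using asm c by (simp add: pos_le_divide_eq)
    then have \<alpha>c: "\<alpha> * c \<le> 1" using \<alpha> by (simp add: algebra_simps)
    obtain \<sigma> z where \<sigma>: "\<sigma> permutes {1..N}" and z0: "z 0 = x"
      and z: "\<forall>i\<in>{1..N}. \<exists>v\<in>D (\<sigma> i) (z (i - 1)). z i = z (i - 1) - \<alpha> *\<^sub>R v"
      and y: "y \<in> prox (\<lambda>y. ereal \<alpha> * g y) (z N)"
      using asm unfolding prr_epoch_def by blast
    obtain u where u: "\<forall>i\<in>{1..N}. u i \<in> D (\<sigma> i) (z (i - 1)) \<and> z i = z (i - 1) - \<alpha> *\<^sub>R u i"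
      using bchoice[of "{1..N}" "\<lambda>i v. v \<in> D (\<sigma> i) (z (i - 1)) \<and> z i = z (i - 1) - \<alpha> *\<^sub>R v"] z by blast
    have le_c: "\<alpha> * (real i * M) \<le> \<alpha> * c" if "i \<le> N" for i
      using that \<alpha> M unfolding c_def by (intro mult_left_mono mult_right_mono) auto
    have in_ball: "q \<in> cball 0 (R + 1)" if "norm (q - x) \<le> \<alpha> * c" for q
      using that \<alpha>c x norm_triangle_sub[of q x] by simp
    have inner: "norm (z i - x) \<le> \<alpha> * (real i * M) \<and> z i = x - \<alpha> *\<^sub>R (\<Sum>j=1..i. u j)" if "i \<le> N" for i
      using that
    proof (induction i)
      case (Suc i)
      then have IH: "norm (z i - x) \<le> \<alpha> * (real i * M)" "z i = x - \<alpha> *\<^sub>R (\<Sum>j=1..i. u j)" by auto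
      have ui: "u (Suc i) \<in> D (\<sigma> (Suc i)) (z i)" "z (Suc i) = z i - \<alpha> *\<^sub>R u (Suc i)"
        using bspec[OF u, of "Suc i"] Suc.prems by auto
      have "\<sigma> (Suc i) \<in> {1..N}" using permutes_in_image[OF \<sigma>, of "Suc i"] Suc.prems by simp
      then have "norm (u (Suc i)) \<le> M"
        using M(2)[OF _ in_ball ui(1)] IH(1) le_c[of i] Suc.prems by simp
      then have "norm (\<alpha> *\<^sub>R u (Suc i)) \<le> \<alpha> * M" using \<alpha> by simp
      moreover have zx: "z (Suc i) - x = (z i - x) - \<alpha> *\<^sub>R u (Suc i)" using ui(2) by simp
      ultimately have "norm (z (Suc i) - x) \<le> \<alpha> * (real i * M) + \<alpha> * M"
        unfolding zx using IH(1) norm_triangle_ineq4[of "z i - x" "\<alpha> *\<^sub>R u (Suc i)"] by linarith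
      moreover have "\<dots> = \<alpha> * (real (Suc i) * M)" by (simp add: algebra_simps)
      moreover have "z (Suc i) = x - \<alpha> *\<^sub>R (\<Sum>j=1..Suc i. u j)"
        using ui(2) IH(2) by (simp add: scaleR_right_distrib)
      ultimately show ?case by simp
    qed (simp add: z0)
    have near: "norm (z i - x) \<le> \<alpha> * c" if "i \<le> N" for i
      using inner[OF that] le_c[OF that] by linarith
    define w where "w = (1 / \<alpha>) *\<^sub>R (z N - y)"
    have w: "w \<in> convex_subdifferential g y"
      unfolding w_def by (rule prox_subgradient(2)[OF \<alpha> y])
    \<comment> \<open>The start of the epoch serves as test point: it lies in the domain, within
      \<open>\<alpha> * c\<close> of the prox center \<open>z N\<close>.\<close>
    have "norm w \<le> 2 * (L + c)"
      unfolding w_def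
      by (rule prox_subgradient_bounded[OF \<alpha> y x(1) _ L(1)])
        (use near[of N] L(2)[of x] x in \<open>auto simp: norm_minus_commute\<close>)
    then have wC: "norm w \<le> C" using C by linarith
    \<comment> \<open>\<open>\<tau> i\<close> is the position at which component \<open>i\<close> is
      processed; reindexing by it turns the sum over positions into a sum over components.\<close>
    define \<tau> where "\<tau> = inv \<sigma>"
    have \<tau>: "\<tau> permutes {1..N}" "\<And>i. \<sigma> (\<tau> i) = i"
      using permutes_inv[OF \<sigma>] permutes_inverses(1)[OF \<sigma>] by (auto simp: \<tau>_def)
    define v where "v = (\<lambda>i. u (\<tau> i))"
    define p where "p = (\<lambda>i. z (\<tau> i - 1))"
    have vp: "v i \<in> D i (p i) \<and> norm (v i) \<le> C \<and> norm (p i - x) \<le> C * \<alpha>" if i: "i \<in> {1..N}" for i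
    proof (intro conjI)
      have \<tau>i: "\<tau> i \<in> {1..N}" using permutes_in_image[OF \<tau>(1)] i by blast
      then show vD: "v i \<in> D i (p i)" using u \<tau>(2)[of i] by (force simp: v_def p_def)
      have px: "norm (p i - x) \<le> \<alpha> * c" unfolding p_def using \<tau>i by (intro near) auto
      then show "norm (v i) \<le> C" using M(2)[OF i in_ball vD] C by linarith
      show "norm (p i - x) \<le> C * \<alpha>"
        using px C \<alpha> by (metis mult.commute mult_left_mono less_imp_le order_trans)
    qed
    have "(\<Sum>i=1..N. v i) = (\<Sum>i=1..N. u i)"
      unfolding v_def using sum.permute[OF \<tau>(1), of u] by (simp add: o_def)
    then have zN: "z N = x - \<alpha> *\<^sub>R (\<Sum>i=1..N. v i)" using inner[of N] by simp
    have "z N - y = \<alpha> *\<^sub>R w" using \<alpha> by (simp add: w_def)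
    then have xy: "x - y = \<alpha> *\<^sub>R ((\<Sum>i=1..N. v i) + w)"
      using zN by (simp add: scaleR_right_distrib algebra_simps)
    have "norm (y - x) \<le> norm (y - z N) + norm (z N - x)"
      using norm_triangle_ineq[of "y - z N" "z N - x"] by simp
    also have "norm (y - z N) = \<alpha> * norm w"
      using \<open>z N - y = \<alpha> *\<^sub>R w\<close> \<alpha> by (metis norm_minus_commute norm_scaleR abs_of_pos)
    also have "\<alpha> * norm w \<le> \<alpha> * (2 * (L + c))"
      using \<open>norm w \<le> 2 * (L + c)\<close> \<alpha> by (intro mult_left_mono) auto
    also have "norm (z N - x) \<le> \<alpha> * c" by (rule near) simp
    finally have "norm (y - x) \<le> \<alpha> * (c + 2 * (L + c))" by (simp add: algebra_simps)
    also have "\<dots> \<le> \<alpha> * C" using C \<alpha> by (intro mult_left_mono) auto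
    finally show "norm (y - x) \<le> C * \<alpha>" by (simp add: mult.commute)
    show "\<exists>v p w. (\<forall>i\<in>{1..N}. v i \<in> D i (p i) \<and> norm (v i) \<le> C \<and> norm (p i - x) \<le> C * \<alpha>) \<and>
      w \<in> convex_subdifferential g y \<and> norm w \<le> C \<and> x - y = \<alpha> *\<^sub>R ((\<Sum>i=1..N. v i) + w)"
      using vp w wC xy by blast
  qed
qed

text \<open>\<open>\<alpha>\<^sub>0\<close> and \<open>C\<close> depend on \<open>R\<close> alone,
  while \<delta> may depend on \<open>p\<close> and \<eta>. The conclusion \<open>norm x < R\<close>
  is placed before the assumption of an epoch: it certifies that a stopped run near \<open>p\<close>
  is still performing genuine epochs.\<close>

lemma prr_epoch_velocity:
  "\<exists>\<alpha>\<^sub>0>0. \<exists>C\<ge>0.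
    (\<forall>\<alpha> x y. 0 < \<alpha> \<and> \<alpha> \<le> \<alpha>\<^sub>0 \<and> x \<in> G \<and> norm x \<le> R \<and> prr_epoch N D g \<alpha> x y \<longrightarrow> norm (y - x) \<le> C * \<alpha>) \<and>
    (\<forall>p \<eta>. norm p < R \<and> 0 < \<eta> \<longrightarrow> (\<exists>\<delta>>0. \<forall>\<alpha> x y. norm (x - p) < \<delta> \<and> 0 < \<alpha> \<and> \<alpha> < \<delta> \<longrightarrow>
      norm x < R \<and> (x \<in> G \<and> prr_epoch N D g \<alpha> x y \<longrightarrow>
        (\<exists>d\<in>D\<^sub>\<Phi> p. norm ((1 / \<alpha>) *\<^sub>R (x - y) - d) \<le> \<eta>))))"
proof -
  obtain \<alpha>\<^sub>0 C where \<alpha>\<^sub>0: "0 < \<alpha>\<^sub>0" and C: "0 \<le> C" and dec: "\<And>\<alpha> x y. \<lbrakk>0 < \<alpha>; \<alpha> \<le> \<alpha>\<^sub>0; x \<in> G; norm x \<le> R;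
    prr_epoch N D g \<alpha> x y\<rbrakk> \<Longrightarrow> norm (y - x) \<le> C * \<alpha> \<and>
    (\<exists>v p w. (\<forall>i\<in>{1..N}. v i \<in> D i (p i) \<and> norm (v i) \<le> C \<and> norm (p i - x) \<le> C * \<alpha>) \<and>
      w \<in> convex_subdifferential g y \<and> norm w \<le> C \<and> x - y = \<alpha> *\<^sub>R ((\<Sum>i=1..N. v i) + w))"
    using prr_epoch_decomposition[of R] by blast
  have "\<exists>\<delta>>0. \<forall>\<alpha> x y. norm (x - p) < \<delta> \<and> 0 < \<alpha> \<and> \<alpha> < \<delta> \<longrightarrow>
      norm x < R \<and> (x \<in> G \<and> prr_epoch N D g \<alpha> x y \<longrightarrow>
        (\<exists>d\<in>D\<^sub>\<Phi> p. norm ((1 / \<alpha>) *\<^sub>R (x - y) - d) \<le> \<eta>))" if p: "norm p < R" and "0 < \<eta>" for p \<eta>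
  proof -
    \<comment> \<open>The tolerance is shared by the \<open>N\<close> component fields and the
      subdifferential.\<close>
    define \<eta>' where "\<eta>' = \<eta> / (real N + 1)"
    have "(real N + 1) * \<eta>' = \<eta>" by (simp add: \<eta>'_def)
    then have sum_\<eta>': "real N * \<eta>' + \<eta>' = \<eta>" by (simp only: distrib_right mult_1)
    have \<eta>': "0 < \<eta>'" using \<open>0 < \<eta>\<close> by (simp add: \<eta>'_def)
    have "\<forall>i\<in>{1..N}. \<exists>\<delta>>0. \<forall>y\<in>ball p \<delta>. \<forall>v\<in>D i y. norm v \<le> C \<longrightarrow> (\<exists>d\<in>D i p. norm (v - d) \<le> \<eta>')"
      using closed_graph_upper_semicontinuous[OF D_props(1) \<eta>'] by blast
    then obtain \<delta>D where \<delta>D: "\<forall>i\<in>{1..N}. 0 < \<delta>D i \<and>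
      (\<forall>y\<in>ball p (\<delta>D i). \<forall>v\<in>D i y. norm v \<le> C \<longrightarrow> (\<exists>d\<in>D i p. norm (v - d) \<le> \<eta>'))"
      by (rule bchoice[THEN exE])
    obtain \<delta>g where \<delta>g: "0 < \<delta>g" "\<forall>y\<in>ball p \<delta>g. \<forall>v\<in>convex_subdifferential g y. norm v \<le> C \<longrightarrow>
        (\<exists>d\<in>convex_subdifferential g p. norm (v - d) \<le> \<eta>')"
      using closed_graph_upper_semicontinuous[OF closed_graph_subdifferential \<eta>'] by blast
    define \<delta>\<^sub>1 where "\<delta>\<^sub>1 = Min (insert \<delta>g (\<delta>D ` {1..N}))"
    have \<delta>\<^sub>1: "0 < \<delta>\<^sub>1" "\<delta>\<^sub>1 \<le> \<delta>g" using \<delta>D \<delta>g(1) by (auto simp: \<delta>\<^sub>1_def)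
    have \<delta>\<^sub>1D: "\<delta>\<^sub>1 \<le> \<delta>D i" if "i \<in> {1..N}" for i
      unfolding \<delta>\<^sub>1_def by (rule Min_le) (use that in auto)
    \<comment> \<open>The quotient by \<open>C + 1\<close> ensures that the points
      \<open>q i\<close> and \<open>y\<close>, which may lie \<open>C * \<alpha>\<close> away from
      \<open>x\<close>, are still within \<open>\<delta>\<^sub>1\<close> of
      \<open>p\<close>.\<close>
    define \<delta> where "\<delta> = min (min \<alpha>\<^sub>0 (R - norm p)) (\<delta>\<^sub>1 / (C + 1))"
    have \<delta>: "0 < \<delta>" "\<delta> \<le> \<alpha>\<^sub>0" "\<delta> \<le> R - norm p" "\<delta> \<le> \<delta>\<^sub>1 / (C + 1)"
      using \<alpha>\<^sub>0 p C \<delta>\<^sub>1 by (auto simp: \<delta>_def)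
    have \<delta>C: "\<delta> + C * \<delta> \<le> \<delta>\<^sub>1" using \<delta>(4) C by (simp add: pos_le_divide_eq algebra_simps)
    show ?thesis
    proof (intro exI[of _ \<delta>] conjI allI impI)
      fix \<alpha> x y assume asm: "norm (x - p) < \<delta> \<and> 0 < \<alpha> \<and> \<alpha> < \<delta>"
      show xR: "norm x < R" using asm \<delta>(3) norm_triangle_sub[of x p] by simp
      assume xy: "x \<in> G \<and> prr_epoch N D g \<alpha> x y"
      obtain v q w where yx: "norm (y - x) \<le> C * \<alpha>"
        and v: "\<And>i. i \<in> {1..N} \<Longrightarrow> v i \<in> D i (q i) \<and> norm (v i) \<le> C \<and> norm (q i - x) \<le> C * \<alpha>"
        and w: "w \<in> convex_subdifferential g y" "norm w \<le> C"
        and eq: "x - y = \<alpha> *\<^sub>R ((\<Sum>i=1..N. v i) + w)"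
        using dec[of \<alpha> x y] asm xy xR \<delta>(2) by force
      have ball: "r \<in> ball p \<delta>\<^sub>1" if "norm (r - x) \<le> C * \<alpha>" for r
      proof -
        have "C * \<alpha> \<le> C * \<delta>" using asm C by (intro mult_left_mono) auto
        then have "norm (r - p) < \<delta>\<^sub>1"
          using that asm \<delta>C norm_triangle_ineq[of "r - x" "x - p"] by simp
        then show ?thesis by (simp add: dist_norm norm_minus_commute)
      qed
      have "\<forall>i\<in>{1..N}. \<exists>d. d \<in> D i p \<and> norm (v i - d) \<le> \<eta>'"
      proof
        fix i assume i: "i \<in> {1..N}"
        then have "q i \<in> ball p (\<delta>D i)" using ball[of "q i"] v[OF i] \<delta>\<^sub>1D[OF i] by auto
        then show "\<exists>d. d \<in> D i p \<and> norm (v i - d) \<le> \<eta>'" using \<delta>D i v[OF i] by blast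
      qed
      then obtain d where d: "\<forall>i\<in>{1..N}. d i \<in> D i p \<and> norm (v i - d i) \<le> \<eta>'"
        by (rule bchoice[THEN exE])
      have "y \<in> ball p \<delta>g" using ball[OF yx] \<delta>\<^sub>1(2) by auto
      then obtain e where e: "e \<in> convex_subdifferential g p" "norm (w - e) \<le> \<eta>'"
        using \<delta>g(2) w by blast
      show "\<exists>d\<in>D\<^sub>\<Phi> p. norm ((1 / \<alpha>) *\<^sub>R (x - y) - d) \<le> \<eta>"
      proof (intro bexI[of _ "(\<Sum>i=1..N. d i) + e"])
        show "(\<Sum>i=1..N. d i) + e \<in> D\<^sub>\<Phi> p" using d e objective_field_iff by blast
        have "(1 / \<alpha>) *\<^sub>R (x - y) - ((\<Sum>i=1..N. d i) + e) = (\<Sum>i=1..N. v i - d i) + (w - e)"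
          using asm by (simp add: eq sum_subtractf)
        also have "norm \<dots> \<le> (\<Sum>i=1..N. norm (v i - d i)) + norm (w - e)"
          by (rule order_trans[OF norm_triangle_ineq]) (simp add: norm_sum)
        also have "(\<Sum>i=1..N. norm (v i - d i)) \<le> (\<Sum>i=1..N. \<eta>')"
          using d by (intro sum_mono) blast
        also have "(\<Sum>i=1..N. \<eta>') + norm (w - e) \<le> \<eta>"
          using e(2) sum_\<eta>' by simp
        finally show "norm ((1 / \<alpha>) *\<^sub>R (x - y) - ((\<Sum>i=1..N. d i) + e)) \<le> \<eta>" by simp
      qed
    qed (rule \<delta>)
  qed
  then show ?thesis using \<alpha>\<^sub>0 C dec by blast
qed

section \<open>Confinement of solutions\<close>

text \<open>A conservative field comes with the almost everywhere differentiability of absolutely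
  continuous curves in the ambient space; applied to \<open>h\<close> times a fixed unit vector it gives
  Rademacher's theorem for real functions of one variable.\<close>

lemma lipschitz_AE_differentiable:
  fixes h :: "real \<Rightarrow> real"
  assumes lip: "L-lipschitz_on {0..T} h" and "0 < T"
  shows "negligible {t \<in> {0..T}. \<not> (\<exists>d. (h has_real_derivative d) (at t within {0..T}))}"
proof -
  define e :: 'a where "e = (SOME b. b \<in> Basis)"
  have "e \<in> Basis" unfolding e_def by (rule SOME_Basis)
  then have e: "e \<bullet> e = 1" "norm e = 1" by auto
  have "L-lipschitz_on {0..T} (\<lambda>t. h t *\<^sub>R e)"
  proof (rule lipschitz_onI[OF _ lipschitz_on_nonneg[OF lip]])
    fix s t assume "s \<in> {0..T}" "t \<in> {0..T}"
    then show "dist (h s *\<^sub>R e) (h t *\<^sub>R e) \<le> L * dist s t"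
      using lipschitz_onD[OF lip, of s t] e(2)
      by (simp add: dist_norm flip: scaleR_left_diff_distrib)
  qed
  from conservative_field_chain_rule[OF conservative[of 1] this \<open>0 < T\<close>] N
  have ae: "negligible {t \<in> {0..T}. \<not> (\<exists>x'. ((\<lambda>t. h t *\<^sub>R e) has_vector_derivative x') (at t within {0..T}) \<and>
    (\<forall>v\<in>D 1 (h t *\<^sub>R e). ((\<lambda>s. f 1 (h s *\<^sub>R e)) has_real_derivative v \<bullet> x') (at t within {0..T})))}"
    by simp
  have "(h has_real_derivative e \<bullet> x') (at t within {0..T})"
    if "((\<lambda>t. h t *\<^sub>R e) has_vector_derivative x') (at t within {0..T})" for t x'
    using bounded_linear.has_vector_derivative[OF bounded_linear_inner_right[of e] that] e(1)
    by (simp add: has_real_derivative_iff_has_vector_derivative)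
  then show ?thesis by (intro negligible_subset[OF ae]) blast
qed

lemma objective_lipschitz_along:
  fixes x :: "real \<Rightarrow> 'a"
  assumes lip: "L-lipschitz_on {0..S} x" and dom: "x ` {0..S} \<subseteq> G"
  shows "\<exists>C. C-lipschitz_on {0..S} (\<lambda>t. gr (x t))" "\<exists>C. C-lipschitz_on {0..S} (\<lambda>t. \<Phi> (x t))"
proof -
  have comp: "compact (x ` {0..S})"
    by (intro compact_continuous_image lipschitz_on_continuous_on[OF lip]) auto
  show g: "\<exists>C. C-lipschitz_on {0..S} (\<lambda>t. gr (x t))"
    using locally_lipschitz_on_compact[OF closed_convex_lipschitz.lip comp dom]
      lipschitz_on_compose2[OF lip] closed_convex_lipschitz_axioms by blast
  have "\<exists>C. C-lipschitz_on {0..S} (\<lambda>t. f i (x t))" if "i \<in> {1..N}" for i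
    using locally_lipschitz_on_compact[OF D_props(4)[OF that] comp] lipschitz_on_compose2[OF lip] by blast
  then have "\<exists>C. C-lipschitz_on {0..S} (\<lambda>t. \<Sum>i=1..N. f i (x t))"
    by (rule lipschitz_on_sum)
  with g show "\<exists>C. C-lipschitz_on {0..S} (\<lambda>t. \<Phi> (x t))"
    using lipschitz_on_add by blast
qed

text \<open>By the subgradient inequality, \<open>gr (x s) - w \<bullet> x s\<close> has a local
  minimum at the interior time \<open>t\<close>, so its derivative there vanishes.\<close>

lemma subdifferential_chain_rule:
  assumes x: "(x has_vector_derivative x') (at t)"
    and g: "((\<lambda>s. gr (x s)) has_real_derivative d) (at t)"
    and w: "w \<in> convex_subdifferential g (x t)"
    and dom: "x ` {a..b} \<subseteq> G" and t: "a < t" "t < b"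
  shows "d = w \<bullet> x'"
proof -
  have "((\<lambda>s. w \<bullet> x s) has_real_derivative w \<bullet> x') (at t)"
    using bounded_linear.has_vector_derivative[OF bounded_linear_inner_right[of w] x]
    by (simp add: has_real_derivative_iff_has_vector_derivative)
  then have der: "((\<lambda>s. gr (x s) - w \<bullet> x s) has_real_derivative d - w \<bullet> x') (at t)"
    by (intro derivative_intros g)
  have "d - w \<bullet> x' = 0"
  proof (rule DERIV_local_min[OF der])
    show "0 < min (t - a) (b - t)" using t by simp
    show "\<forall>s. \<bar>t - s\<bar> < min (t - a) (b - t) \<longrightarrow> gr (x t) - w \<bullet> x t \<le> gr (x s) - w \<bullet> x s"
    proof (intro allI impI)
      fix s assume "\<bar>t - s\<bar> < min (t - a) (b - t)"
      then have "x s \<in> G" using dom by (intro subsetD[OF dom] imageI) auto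
      then have "gr (x t) + w \<bullet> (x s - x t) \<le> gr (x s)" using w unfolding subdifferential_iff by blast
      then show "gr (x t) - w \<bullet> x t \<le> gr (x s) - w \<bullet> x s" by (simp add: inner_diff_right)
    qed
  qed
  then show ?thesis by simp
qed

text \<open>Along a solution \<open>\<Phi>\<close> has derivative \<open>- |x'|\<^sup>2\<close>, and \<open>2 u \<bullet> x' - 1 \<le> |x'|\<^sup>2\<close> for a unit
  vector \<open>u\<close>; so \<open>\<Phi> (x t) + 2 u \<bullet> x t - t\<close> decreases. This bounds the displacement without
  integrating \<open>|x'|\<^sup>2\<close>.\<close>

lemma displacement_bound:
  assumes lip: "L-lipschitz_on {0..S} x" and "0 < S" and dom: "x ` {0..S} \<subseteq> G"
    and sol: "negligible {t \<in> {0..S}. \<not> (\<exists>v\<in>D\<^sub>\<Phi> (x t). (x has_vector_derivative - v) (at t within {0..S}))}"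
  shows "2 * norm (x S - x 0) \<le> S + \<Phi> (x 0) - \<Phi> (x S)"
proof -
  \<comment> \<open>A unit vector, or 0 if the end points coincide;
    \<open>u \<bullet> u \<le> 1\<close> covers both cases.\<close>
  define u where "u = sgn (x S - x 0)"
  have "sgn y \<bullet> y = norm y" "sgn y \<bullet> sgn y \<le> 1" for y :: 'a
    by (cases "y = 0") (simp_all add: dot_square_norm norm_sgn, simp add: sgn_div_norm dot_square_norm power2_eq_square)
  then have u: "u \<bullet> (x S - x 0) = norm (x S - x 0)" "u \<bullet> u \<le> 1"
    unfolding u_def by blast+
  define \<psi> where "\<psi> = (\<lambda>t. \<Phi> (x t) + 2 * (u \<bullet> x t) - t)"
  obtain C where C: "C-lipschitz_on {0..S} (\<lambda>t. \<Phi> (x t))"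
    using objective_lipschitz_along(2)[OF lip dom] by blast
  have "(norm u * L)-lipschitz_on {0..S} (\<lambda>t. u \<bullet> x t)"
  proof (rule lipschitz_onI)
    fix s t assume st: "s \<in> {0..S}" "t \<in> {0..S}"
    have "dist (u \<bullet> x s) (u \<bullet> x t) \<le> norm u * dist (x s) (x t)"
      using Cauchy_Schwarz_ineq2[of u "x s - x t"] by (simp add: dist_norm inner_diff_right)
    also have "\<dots> \<le> norm u * (L * dist s t)"
      by (intro mult_left_mono lipschitz_onD[OF lip] st) auto
    finally show "dist (u \<bullet> x s) (u \<bullet> x t) \<le> norm u * L * dist s t" by (simp add: mult.assoc)
  qed (use lipschitz_on_nonneg[OF lip] in simp)
  then have \<psi>lip: "(C + \<bar>2\<bar> * (norm u * L) + 1)-lipschitz_on {0..S} \<psi>"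
    unfolding \<psi>_def
    by (intro lipschitz_on_diff lipschitz_on_add lipschitz_on_cmult_real C lipschitz_on_id)
  define E1 where "E1 = {t \<in> {0..S}. \<not> (\<exists>v\<in>D\<^sub>\<Phi> (x t). (x has_vector_derivative - v) (at t within {0..S}))}"
  define E2 where "E2 = {t \<in> {0..S}. \<not> (\<exists>d. ((\<lambda>t. gr (x t)) has_real_derivative d) (at t within {0..S}))}"
  define E3 where "E3 = (\<lambda>i. {t \<in> {0..S}. \<not> (\<exists>x'. (x has_vector_derivative x') (at t within {0..S}) \<and>
    (\<forall>v\<in>D i (x t). ((\<lambda>s. f i (x s)) has_real_derivative v \<bullet> x') (at t within {0..S})))})"
  \<comment> \<open>The end points are added so that all remaining derivatives are two-sided and
    therefore unique; this identifies the derivative in each chain rule with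
    \<open>- v\<close>.\<close>
  define E where "E = {0, S} \<union> E1 \<union> E2 \<union> (\<Union>i\<in>{1..N}. E3 i)"
  have "negligible E1" unfolding E1_def by (rule sol)
  moreover have "negligible E2"
    using objective_lipschitz_along(1)[OF lip dom] lipschitz_AE_differentiable[OF _ \<open>0 < S\<close>]
    unfolding E2_def by blast
  moreover have "negligible (E3 i)" if "i \<in> {1..N}" for i
    unfolding E3_def by (rule conservative_field_chain_rule[OF conservative[OF that] lip \<open>0 < S\<close>])
  then have "negligible (\<Union>i\<in>{1..N}. E3 i)" by (intro negligible_Union) auto
  moreover have "negligible {0, S}" by (simp add: negligible_finite)
  ultimately have "negligible E" unfolding E_def by (intro negligible_Un)
  moreover have "\<exists>d\<le>0. (\<psi> has_real_derivative d) (at t within {0..S})" if t: "t \<in> {0..S}" "t \<notin> E" for t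
  proof -
    have t0: "0 < t" "t < S" using t by (auto simp: E_def order_le_less)
    have at: "at t within {0..S} = at t" using t0 by (rule at_within_Icc_at)
    have notin: "t \<notin> E1" "t \<notin> E2" "\<And>i. i \<in> {1..N} \<Longrightarrow> t \<notin> E3 i"
      using t(2) unfolding E_def by blast+
    have "\<exists>v\<in>D\<^sub>\<Phi> (x t). (x has_vector_derivative - v) (at t within {0..S})"
      using notin(1) t(1) unfolding E1_def by blast
    then obtain v where v: "v \<in> D\<^sub>\<Phi> (x t)" and dx: "(x has_vector_derivative - v) (at t)"
      unfolding at by blast
    have "\<exists>d. ((\<lambda>t. gr (x t)) has_real_derivative d) (at t within {0..S})"
      using notin(2) t(1) unfolding E2_def by blast
    then obtain d where dg: "((\<lambda>t. gr (x t)) has_real_derivative d) (at t)"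
      unfolding at by blast
    obtain vs w where vs: "\<And>i. i \<in> {1..N} \<Longrightarrow> vs i \<in> D i (x t)" and w: "w \<in> convex_subdifferential g (x t)"
      and veq: "v = (\<Sum>i=1..N. vs i) + w"
      using v objective_field_iff by blast
    have "((\<lambda>s. f i (x s)) has_real_derivative vs i \<bullet> (- v)) (at t)" if i: "i \<in> {1..N}" for i
    proof -
      have "\<exists>x'. (x has_vector_derivative x') (at t within {0..S}) \<and>
          (\<forall>v\<in>D i (x t). ((\<lambda>s. f i (x s)) has_real_derivative v \<bullet> x') (at t within {0..S}))"
        using notin(3)[OF i] t(1) unfolding E3_def by blast
      then obtain x' where x': "(x has_vector_derivative x') (at t)"
        "\<forall>v\<in>D i (x t). ((\<lambda>s. f i (x s)) has_real_derivative v \<bullet> x') (at t)"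
        unfolding at by blast
      moreover have "x' = - v" using vector_derivative_unique_at[OF x'(1) dx] .
      ultimately show ?thesis using vs[OF i] by blast
    qed
    then have df: "((\<lambda>s. \<Sum>i=1..N. f i (x s)) has_real_derivative (\<Sum>i=1..N. vs i \<bullet> (- v))) (at t)"
      by (intro DERIV_sum)
    have dg: "((\<lambda>t. gr (x t)) has_real_derivative w \<bullet> (- v)) (at t)"
      using dg subdifferential_chain_rule[OF dx dg w dom t0] by simp
    have du: "((\<lambda>s. u \<bullet> x s) has_real_derivative u \<bullet> (- v)) (at t)"
      using bounded_linear.has_vector_derivative[OF bounded_linear_inner_right[of u] dx]
      by (simp add: has_real_derivative_iff_has_vector_derivative)
    have "(\<psi> has_real_derivative (\<Sum>i=1..N. vs i \<bullet> (- v)) + w \<bullet> (- v) + 2 * (u \<bullet> (- v)) - 1) (at t)"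
      unfolding \<psi>_def by (intro DERIV_diff DERIV_add DERIV_cmult df dg du DERIV_ident)
    moreover have "(\<Sum>i=1..N. vs i \<bullet> (- v)) + w \<bullet> (- v) = - (v \<bullet> v)"
    proof -
      have "(\<Sum>i=1..N. vs i \<bullet> (- v)) + w \<bullet> (- v) = ((\<Sum>i=1..N. vs i) + w) \<bullet> (- v)"
        by (simp only: inner_sum_left inner_add_left)
      also have "\<dots> = - (v \<bullet> v)" by (simp only: veq[symmetric] inner_minus_right)
      finally show ?thesis .
    qed
    ultimately have "(\<psi> has_real_derivative - (v \<bullet> v) - 2 * (u \<bullet> v) - 1) (at t)" by simp
    \<comment> \<open>Expanding this square and using \<open>u \<bullet> u \<le> 1\<close> gives the
      sign of the derivative of \<psi>.\<close>
    moreover have "0 \<le> (v + u) \<bullet> (v + u)" by simp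
    then have "- (v \<bullet> v) - 2 * (u \<bullet> v) - 1 \<le> 0"
      using u(2) by (simp add: inner_add_left inner_add_right inner_commute)
    ultimately show ?thesis unfolding at by blast
  qed
  then have "{t \<in> {0..S}. \<not> (\<exists>d\<le>0. (\<psi> has_real_derivative d) (at t within {0..S}))} \<subseteq> E" by blast
  ultimately have "negligible {t \<in> {0..S}. \<not> (\<exists>d\<le>0. (\<psi> has_real_derivative d) (at t within {0..S}))}"
    by (rule negligible_subset)
  then have "\<psi> S \<le> \<psi> 0"
    using \<open>0 < S\<close> by (intro lipschitz_deriv_nonpos_imp_le[OF _ \<psi>lip]) auto
  then show ?thesis using u(1) by (simp add: \<psi>_def inner_diff_right)
qed

text \<open>A continuity argument: the inclusion is known only where the norm is below
  \<open>R\<close>. Up to a first time of norm at least \<open>R\<close> the displacement bound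
  applies, with \<open>\<Phi> (x 0) - \<Phi> (x s) \<le> B - m\<close>, and yields a norm strictly
  below \<open>R\<close> at that very time.\<close>

lemma solution_confined:
  assumes lip: "L-lipschitz_on {0..T} x" and "0 < T" and dom: "x ` {0..T} \<subseteq> G"
    and x0: "norm (x 0) \<le> \<rho>" "\<Phi> (x 0) \<le> B" and R: "\<rho> + (T + (B - m)) / 2 < R"
    and sol: "negligible {t \<in> {0..T}. norm (x t) < R \<and>
      \<not> (\<exists>v\<in>D\<^sub>\<Phi> (x t). (x has_vector_derivative - v) (at t within {0..T}))}" (is "negligible ?E")
    and t: "t \<in> {0..T}"
  shows "norm (x t) \<le> \<rho> + (T + (B - m)) / 2"
proof -
  have cont: "continuous_on {0..T} (\<lambda>t. norm (x t))"
    by (intro continuous_on_norm lipschitz_on_continuous_on[OF lip])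
  have Bm: "m \<le> B" using lower_bound_dom[of "x 0"] dom x0(2) \<open>0 < T\<close> by (force simp: image_subset_iff)
  have bound: "norm (x s) \<le> \<rho> + (T + (B - m)) / 2" if s: "s \<in> {0..T}" and "\<And>t. t \<in> {0..<s} \<Longrightarrow> norm (x t) < R" for s
  proof (cases "s = 0")
    case True
    then show ?thesis using x0 Bm \<open>0 < T\<close> by (simp add: add_increasing2)
  next
    case False
    then have "0 < s" using s by simp
    \<comment> \<open>The time \<open>s\<close> itself is added because \<open>norm (x s)\<close>
      may already equal \<open>R\<close>.\<close>
    have sub: "{t \<in> {0..s}. \<not> (\<exists>v\<in>D\<^sub>\<Phi> (x t). (x has_vector_derivative - v) (at t within {0..s}))} \<subseteq> insert s ?E"
    proof
      fix t assume t: "t \<in> {t \<in> {0..s}. \<not> (\<exists>v\<in>D\<^sub>\<Phi> (x t). (x has_vector_derivative - v) (at t within {0..s}))}"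
      have "\<not> (\<exists>v\<in>D\<^sub>\<Phi> (x t). (x has_vector_derivative - v) (at t within {0..T}))"
        using t s has_vector_derivative_within_subset[where T="{0..s}" and S="{0..T}" and f=x] by force
      then show "t \<in> insert s ?E" using t s that(2)[of t] by (cases "t = s") auto
    qed
    have "negligible (insert s ?E)" using sol by (simp only: negligible_insert)
    then have "negligible {t \<in> {0..s}. \<not> (\<exists>v\<in>D\<^sub>\<Phi> (x t). (x has_vector_derivative - v) (at t within {0..s}))}"
      using sub by (rule negligible_subset)
    moreover have "L-lipschitz_on {0..s} x" using s by (intro lipschitz_on_subset[OF lip]) auto
    moreover have "x ` {0..s} \<subseteq> G" using dom s by (auto simp: image_subset_iff)
    ultimately have "2 * norm (x s - x 0) \<le> s + \<Phi> (x 0) - \<Phi> (x s)"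
      using \<open>0 < s\<close> by (intro displacement_bound)
    moreover have "m \<le> \<Phi> (x s)" using dom s by (intro lower_bound_dom) auto
    ultimately have "norm (x s - x 0) \<le> (T + (B - m)) / 2" using x0(2) s by simp
    then show ?thesis using norm_triangle_sub[of "x s" "x 0"] x0(1) by linarith
  qed
  have "norm (x t) < R" if "t \<in> {0..T}" for t
  proof (rule ccontr)
    assume "\<not> norm (x t) < R"
    define A where "A = {s \<in> {0..T}. R \<le> norm (x s)}"
    have "closed A"
      using continuous_closed_preimage[OF cont closed_atLeastAtMost, of "{R..}"]
      by (simp add: A_def vimage_def Int_def)
    moreover have "bounded A"
      by (rule bounded_subset[OF bounded_closed_interval[of 0 T]]) (auto simp: A_def)
    ultimately have "compact A" by (simp add: compact_eq_bounded_closed)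
    moreover have "A \<noteq> {}" using that \<open>\<not> norm (x t) < R\<close> by (auto simp: A_def)
    ultimately obtain s where s: "s \<in> A" "\<And>t. t \<in> A \<Longrightarrow> s \<le> t"
      using compact_attains_inf[of A] by blast
    have "norm (x r) < R" if "r \<in> {0..<s}" for r
    proof (rule ccontr)
      assume "\<not> norm (x r) < R"
      then have "r \<in> A" using that s(1) by (auto simp: A_def)
      then show False using s(2)[of r] that by simp
    qed
    then have "norm (x s) \<le> \<rho> + (T + (B - m)) / 2" using bound[of s] s(1) by (simp add: A_def)
    then show False using s(1) R by (simp add: A_def)
  qed
  then show ?thesis using bound[OF t] t by simp
qed

end

section \<open>Shadowing\<close>

text \<open>The constants are fixed in order of dependence: \<rho> and \<open>B\<close> come from
  the initial set, \<open>R\<close> from these and the horizon, and only then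
  \<open>\<alpha>\<^sub>0\<close> and \<open>C\<close> from \<open>R\<close>.\<close>

locale prr_horizon = prr g N f D m
  for g :: "'a::euclidean_space \<Rightarrow> ereal" and N f D m +
  fixes X\<^sub>0 :: "'a set" and T \<rho> B R \<alpha>\<^sub>0 C :: real
  assumes X\<^sub>0: "compact X\<^sub>0" "X\<^sub>0 \<subseteq> G" and T: "0 < T"
    and \<rho>: "\<And>x. x \<in> X\<^sub>0 \<Longrightarrow> norm x \<le> \<rho>" and B: "\<And>x. x \<in> X\<^sub>0 \<Longrightarrow> \<Phi> x \<le> B"
    and R: "\<rho> + (T + (B - m)) / 2 < R"
    and \<alpha>\<^sub>0: "0 < \<alpha>\<^sub>0" and C: "0 \<le> C"
    and epoch_bound: "\<And>\<alpha> x y. \<lbrakk>0 < \<alpha>; \<alpha> \<le> \<alpha>\<^sub>0; x \<in> G; norm x \<le> R; prr_epoch N D g \<alpha> x y\<rbrakk> \<Longrightarrow>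
      norm (y - x) \<le> C * \<alpha>"
    and epoch_velocity: "\<And>p \<eta>. \<lbrakk>norm p < R; 0 < \<eta>\<rbrakk> \<Longrightarrow> \<exists>\<delta>>0. \<forall>\<alpha> x y. norm (x - p) < \<delta> \<and> 0 < \<alpha> \<and> \<alpha> < \<delta> \<longrightarrow>
      norm x < R \<and> (x \<in> G \<and> prr_epoch N D g \<alpha> x y \<longrightarrow>
        (\<exists>d\<in>D\<^sub>\<Phi> p. norm ((1 / \<alpha>) *\<^sub>R (x - y) - d) \<le> \<eta>))"
begin

abbreviation "R\<^sub>0 \<equiv> \<rho> + (T + (B - m)) / 2"

text \<open>Epochs are uniformly controlled only while the iterate stays in the ball of radius \<open>R\<close>, so
  iterates that leave the ball are frozen; the a priori bound \<open>R\<^sub>0 < R\<close> on solutions shows afterwards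
  that this never happens before time \<open>T\<close>.\<close>

definition frozen_epoch :: "real \<Rightarrow> 'a \<Rightarrow> 'a \<Rightarrow> bool" where
  "frozen_epoch \<alpha> x y \<longleftrightarrow> (if norm x < R then prr_epoch N D g \<alpha> x y else y = x)"

text \<open>Besides the required properties it records two quantitative ones: the Lipschitz constant
  controls the curve over the short remaining time of a run with summable steps, and the bound
  \<open>R\<^sub>0\<close> shows that a nearby run was never frozen.\<close>

definition confined_solution :: "(real \<Rightarrow> 'a) \<Rightarrow> bool" where
  "confined_solution X \<longleftrightarrow> C-lipschitz_on {0..T} X \<and> X ` {0..T} \<subseteq> G \<and> X 0 \<in> X\<^sub>0 \<and>
    inclusion_solution T D\<^sub>\<Phi> X \<and> (\<forall>t\<in>{0..T}. norm (X t) \<le> R\<^sub>0)"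

lemma frozen_epoch_dom: "\<lbrakk>0 < \<alpha>; x \<in> G; frozen_epoch \<alpha> x y\<rbrakk> \<Longrightarrow> y \<in> G"
  unfolding frozen_epoch_def using prr_epoch_dom by (auto split: if_splits)

lemma frozen_epoch_bound:
  "\<lbrakk>0 < \<alpha>; \<alpha> \<le> \<alpha>\<^sub>0; x \<in> G; frozen_epoch \<alpha> x y\<rbrakk> \<Longrightarrow> norm (y - x) \<le> C * \<alpha>"
  unfolding frozen_epoch_def using epoch_bound C by (auto split: if_splits)

lemma frozen_epoch_exists: "0 < \<alpha> \<Longrightarrow> \<exists>y. frozen_epoch \<alpha> x y"
  unfolding frozen_epoch_def using prr_epoch_exists[of \<alpha> x] by (cases "norm x < R") auto

lemma frozen_sequence_dom:
  assumes "y 0 \<in> X\<^sub>0" "\<And>k. 0 < a k" "\<And>k. frozen_epoch (a k) (y k) (y (Suc k))"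
  shows "y k \<in> G"
proof (induction k)
  case 0
  then show ?case using assms(1) X\<^sub>0(2) by blast
next
  case (Suc k)
  then show ?case using frozen_epoch_dom assms by blast
qed

text \<open>Differentiability almost everywhere is read off from the conservative field
  \<open>D 1\<close>. The inclusion, first available only inside the ball, gives confinement by
  \<open>R\<^sub>0\<close>; since \<open>R\<^sub>0 < R\<close>, the restriction to the ball then
  holds at all times.\<close>

lemma confined_solutionI:
  assumes lip: "C-lipschitz_on {0..T} x" and dom: "x ` {0..T} \<subseteq> G" and x0: "x 0 \<in> X\<^sub>0"
    and der: "\<And>t x'. \<lbrakk>0 \<le> t; t < T; norm (x t) < R; (x has_vector_derivative x') (at t within {0..T})\<rbrakk> \<Longrightarrow>
      - x' \<in> D\<^sub>\<Phi> (x t)"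
  shows "confined_solution x"
proof -
  define E where "E = {t \<in> {0..T}. \<not> (\<exists>x'. (x has_vector_derivative x') (at t within {0..T}) \<and>
    (\<forall>v\<in>D 1 (x t). ((\<lambda>s. f 1 (x s)) has_real_derivative v \<bullet> x') (at t within {0..T})))}"
  have "negligible E"
    unfolding E_def using conservative_field_chain_rule[OF conservative[of 1] lip T] N by simp
  then have negE: "negligible (insert T E)" by (simp only: negligible_insert)
  have sol: "\<exists>v\<in>D\<^sub>\<Phi> (x t). (x has_vector_derivative - v) (at t within {0..T})"
    if t: "t \<in> {0..T}" "t \<notin> insert T E" "norm (x t) < R" for t
  proof -
    obtain x' where x': "(x has_vector_derivative x') (at t within {0..T})"
      using t unfolding E_def by blast
    moreover have "t < T" using t by auto
    ultimately have "- x' \<in> D\<^sub>\<Phi> (x t)" using der t by simp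
    then show ?thesis using x' by (intro bexI[of _ "- x'"]) auto
  qed
  then have "{t \<in> {0..T}. norm (x t) < R \<and>
      \<not> (\<exists>v\<in>D\<^sub>\<Phi> (x t). (x has_vector_derivative - v) (at t within {0..T}))} \<subseteq> insert T E" by blast
  then have "negligible {t \<in> {0..T}. norm (x t) < R \<and>
      \<not> (\<exists>v\<in>D\<^sub>\<Phi> (x t). (x has_vector_derivative - v) (at t within {0..T}))}"
    by (rule negligible_subset[OF negE])
  then have le: "norm (x t) \<le> R\<^sub>0" if "t \<in> {0..T}" for t
    using solution_confined[OF lip T dom \<rho>[OF x0] B[OF x0] R _ that] by blast
  have "{t \<in> {0..T}. \<not> (\<exists>v\<in>D\<^sub>\<Phi> (x t). (x has_vector_derivative - v) (at t within {0..T}))} \<subseteq> insert T E"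
  proof
    fix t assume t: "t \<in> {t \<in> {0..T}. \<not> (\<exists>v\<in>D\<^sub>\<Phi> (x t). (x has_vector_derivative - v) (at t within {0..T}))}"
    then have "norm (x t) < R" using le[of t] R by simp
    then show "t \<in> insert T E" using sol t by blast
  qed
  then have "negligible {t \<in> {0..T}. \<not> (\<exists>v\<in>D\<^sub>\<Phi> (x t). (x has_vector_derivative - v) (at t within {0..T}))}"
    by (rule negligible_subset[OF negE])
  then have "inclusion_solution T D\<^sub>\<Phi> x"
    unfolding inclusion_solution_def
    by (subst AE_lebesgue_on_iff_negligible) (auto intro: lipschitz_imp_abs_continuous_on[OF lip])
  then show ?thesis unfolding confined_solution_def using lip dom x0 le by blast
qed

lemma frozen_sequence_shadowed_long:
  assumes "0 < \<epsilon>"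
  shows "\<exists>\<beta>>0. \<beta> \<le> \<alpha>\<^sub>0 \<and> (\<forall>a y. (\<forall>k. 0 < a k \<and> a k \<le> \<beta>) \<and> y 0 \<in> X\<^sub>0 \<and>
    (\<forall>k. frozen_epoch (a k) (y k) (y (Suc k))) \<and> (\<exists>K. T \<le> sum a {..<K}) \<longrightarrow>
    (\<exists>X. confined_solution X \<and> (\<forall>k. sum a {..<k} \<le> T \<longrightarrow> norm (y k - X (sum a {..<k})) \<le> \<epsilon>)))"
proof (rule ccontr)
  define P where "P = (\<lambda>\<beta> a y. (\<forall>k. 0 < a k \<and> a k \<le> \<beta>) \<and> y 0 \<in> X\<^sub>0 \<and>
    (\<forall>k. frozen_epoch (a k) (y k) (y (Suc k))) \<and> (\<exists>K. T \<le> sum a {..<K}))"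
  define Q where "Q = (\<lambda>(a :: nat \<Rightarrow> real) y. \<exists>X. confined_solution X \<and>
    (\<forall>k. sum a {..<k} \<le> T \<longrightarrow> norm (y k - X (sum a {..<k})) \<le> \<epsilon>))"
  assume "\<not> ?thesis"
  then have neg: "\<not> (\<exists>\<beta>>0. \<beta> \<le> \<alpha>\<^sub>0 \<and> (\<forall>a y. P \<beta> a y \<longrightarrow> Q a y))"
    unfolding P_def Q_def by simp
  \<comment> \<open>Thresholds that stay below \<open>\<alpha>\<^sub>0\<close> and tend to 0; each
    of them fails for some run.\<close>
  define A where "A = (\<lambda>j. \<alpha>\<^sub>0 / real (Suc j))"
  have A: "0 < A j" "A j \<le> \<alpha>\<^sub>0" for j using \<alpha>\<^sub>0 by (auto simp: A_def field_simps)
  have A0: "A \<longlonglongrightarrow> 0"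
    unfolding A_def using LIMSEQ_Suc[OF lim_const_over_n[of \<alpha>\<^sub>0]] by simp
  have "\<forall>j. \<exists>a y. P (A j) a y \<and> \<not> Q a y" using neg A by blast
  then obtain a Y where aY: "\<And>j. P (A j) (a j) (Y j)" "\<And>j. \<not> Q (a j) (Y j)" by metis
  have pos: "0 < a j k" and small: "a j k \<le> A j" and init: "Y j 0 \<in> X\<^sub>0"
    and step: "frozen_epoch (a j k) (Y j k) (Y j (Suc k))" and long: "\<exists>K. T \<le> sum (a j) {..<K}" for j k
    using aY(1)[of j] unfolding P_def by blast+
  have YG: "Y j k \<in> G" for j k using frozen_sequence_dom[of "Y j" "a j"] init pos step by blast
  have bound: "norm (Y j (Suc k) - Y j k) \<le> C * a j k" for j k
    using frozen_epoch_bound[OF pos order_trans[OF small A(2)] YG step] .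
  show False
  proof (rule euler_polygons_limit[OF pos small A0 bound X\<^sub>0(1) init T long])
    fix x r assume r: "strict_mono (r :: nat \<Rightarrow> nat)" and lip: "C-lipschitz_on {0..T} x" and x0: "x 0 \<in> X\<^sub>0"
      and unif: "\<And>e. 0 < e \<Longrightarrow> \<exists>n. \<forall>j\<ge>n. \<forall>k. sum (a (r j)) {..<k} \<le> T \<longrightarrow>
        norm (Y (r j) k - x (sum (a (r j)) {..<k})) < e"
      and lim: "\<And>t. t \<in> {0..T} \<Longrightarrow> \<exists>k. (\<lambda>j. Y (r j) (k j)) \<longlonglongrightarrow> x t"
      and der: "\<And>t x' E. \<lbrakk>0 \<le> t; t < T; (x has_vector_derivative x') (at t within {0..T}); convex E; closed E;
      \<And>\<eta>. 0 < \<eta> \<Longrightarrow> \<exists>\<delta>>0. \<forall>j k. norm (Y j k - x t) < \<delta> \<and> a j k < \<delta> \<longrightarrow>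
        (\<exists>d\<in>E. norm ((1 / a j k) *\<^sub>R (Y j k - Y j (Suc k)) - d) \<le> \<eta>)\<rbrakk> \<Longrightarrow> - x' \<in> E"
    have dom: "x ` {0..T} \<subseteq> G"
    proof
      fix u assume "u \<in> x ` {0..T}"
      then obtain t where t: "t \<in> {0..T}" "u = x t" by blast
      then obtain k where "(\<lambda>j. Y (r j) (k j)) \<longlonglongrightarrow> u" using lim by blast
      then show "u \<in> G" by (rule closed_sequentially[OF closed YG])
    qed
    have "confined_solution x"
    proof (rule confined_solutionI[OF lip dom x0])
      fix t x' assume t: "0 \<le> t" "t < T" "norm (x t) < R" and x': "(x has_vector_derivative x') (at t within {0..T})"
      show "- x' \<in> D\<^sub>\<Phi> (x t)"
      proof (rule der[OF t(1,2) x' convex_objective_field closed_objective_field])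
        fix \<eta> :: real assume "0 < \<eta>"
        from epoch_velocity[OF t(3) this] obtain \<delta> where \<delta>: "0 < \<delta>"
          and vel: "\<forall>\<alpha> u y. norm (u - x t) < \<delta> \<and> 0 < \<alpha> \<and> \<alpha> < \<delta> \<longrightarrow>
            norm u < R \<and> (u \<in> G \<and> prr_epoch N D g \<alpha> u y \<longrightarrow>
              (\<exists>d\<in>D\<^sub>\<Phi> (x t). norm ((1 / \<alpha>) *\<^sub>R (u - y) - d) \<le> \<eta>))"
          by (elim exE conjE)
        have "\<exists>d\<in>D\<^sub>\<Phi> (x t). norm ((1 / a j k) *\<^sub>R (Y j k - Y j (Suc k)) - d) \<le> \<eta>"
          if near: "norm (Y j k - x t) < \<delta>" "a j k < \<delta>" for j k
        proof -
          \<comment> \<open>Being within \<delta> of \<open>x t\<close> forces the iterate into the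
            open ball of radius \<open>R\<close>, so its frozen epoch is a genuine one and the
            velocity estimate applies.\<close>
          note * = vel[THEN spec[where x = "a j k"], THEN spec[where x = "Y j k"],
              THEN spec[where x = "Y j (Suc k)"], THEN mp, OF conjI[OF near(1) conjI[OF pos near(2)]]]
          then have "prr_epoch N D g (a j k) (Y j k) (Y j (Suc k))"
            using step[of j k] by (simp add: frozen_epoch_def)
          then show ?thesis using * YG by blast
        qed
        then show "\<exists>\<delta>>0. \<forall>j k. norm (Y j k - x t) < \<delta> \<and> a j k < \<delta> \<longrightarrow>
          (\<exists>d\<in>D\<^sub>\<Phi> (x t). norm ((1 / a j k) *\<^sub>R (Y j k - Y j (Suc k)) - d) \<le> \<eta>)"
          using \<delta> by blast
      qed
    qed
    moreover obtain n where "\<forall>k. sum (a (r n)) {..<k} \<le> T \<longrightarrow>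
        norm (Y (r n) k - x (sum (a (r n)) {..<k})) < \<epsilon>"
      using unif[OF \<open>0 < \<epsilon>\<close>] by blast
    ultimately have "Q (a (r n)) (Y (r n))" unfolding Q_def by (meson less_imp_le)
    then show False using aY(2) by blast
  qed
qed

text \<open>If the step sizes sum to less than \<open>T\<close>, the iterates are Cauchy in the elapsed time; continuing
  from a late iterate with constant steps reduces to the long case.\<close>

lemma frozen_sequence_shadowed:
  assumes "0 < \<epsilon>"
  shows "\<exists>\<beta>>0. \<forall>a y. (\<forall>k. 0 < a k \<and> a k \<le> \<beta>) \<and> y 0 \<in> X\<^sub>0 \<and>
    (\<forall>k. frozen_epoch (a k) (y k) (y (Suc k))) \<longrightarrow>
    (\<exists>X. confined_solution X \<and> (\<forall>k. sum a {..<k} \<le> T \<longrightarrow> norm (y k - X (sum a {..<k})) \<le> \<epsilon>))"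
proof -
  have "0 < \<epsilon> / 2" using assms by simp
  from frozen_sequence_shadowed_long[OF this] obtain \<beta> where \<beta>: "0 < \<beta>" "\<beta> \<le> \<alpha>\<^sub>0"
    and long: "\<And>a y. \<lbrakk>\<And>k. 0 < a k; \<And>k. a k \<le> \<beta>; y 0 \<in> X\<^sub>0; \<And>k. frozen_epoch (a k) (y k) (y (Suc k));
      \<exists>K. T \<le> sum a {..<K}\<rbrakk> \<Longrightarrow> \<exists>X. confined_solution X \<and>
      (\<forall>k. sum a {..<k} \<le> T \<longrightarrow> norm (y k - X (sum a {..<k})) \<le> \<epsilon> / 2)" by metis
  have "\<exists>X. confined_solution X \<and> (\<forall>k. sum a {..<k} \<le> T \<longrightarrow> norm (y k - X (sum a {..<k})) \<le> \<epsilon>)"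
    if pos: "\<And>k. 0 < a k" and le: "\<And>k. a k \<le> \<beta>" and y0: "y 0 \<in> X\<^sub>0"
      and step: "\<And>k. frozen_epoch (a k) (y k) (y (Suc k))" for a y
  proof (cases "\<exists>K. T \<le> sum a {..<K}")
    case True
    from long[OF pos le y0 step True] obtain X where "confined_solution X"
      and "\<And>k. sum a {..<k} \<le> T \<Longrightarrow> norm (y k - X (sum a {..<k})) \<le> \<epsilon> / 2" by blast
    then show ?thesis using \<open>0 < \<epsilon>\<close> by (intro exI[of _ X]) force
  next
    case False
    define s where "s = (\<lambda>k. sum a {..<k})"
    have sT: "s k < T" for k using False by (simp add: s_def not_le)
    have mono: "s k \<le> s l" if "k \<le> l" for k l unfolding s_def by (rule sum_lessThan_mono[OF pos that])
    have s0: "0 \<le> s k" for k using mono[of 0 k] by (simp add: s_def)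
    \<comment> \<open>The error budget is \<open>\<epsilon> / 2\<close> for shadowing up to epoch
      \<open>K\<close>, and \<open>\<epsilon> / 4\<close> each for the motion of the iterates and of
      the curve over the elapsed time after \<open>K\<close>, which is at most
      \<open>e\<close>.\<close>
    define e where "e = \<epsilon> / (4 * (C + 1))"
    have e: "0 < e" "C * e \<le> \<epsilon> / 4" using C \<open>0 < \<epsilon>\<close> by (auto simp: e_def field_simps)
    have bdd: "bdd_above (range s)" using sT by (intro bdd_aboveI[of _ T]) (auto simp: less_imp_le)
    have "Sup (range s) - e < Sup (range s)" using e by simp
    then obtain K where K: "Sup (range s) - e < s K"
      using less_cSup_iff[OF _ bdd] by blast
    have tail: "s k - s K \<le> e" for k
      using cSup_upper[OF _ bdd, of "s k"] K by fastforce
    define nxt where "nxt = (\<lambda>u. SOME v. frozen_epoch \<beta> u v)"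
    have nxt: "frozen_epoch \<beta> u (nxt u)" for u
      unfolding nxt_def using frozen_epoch_exists[OF \<beta>(1)] by (rule someI_ex)
    define a' where "a' = (\<lambda>k. if k < K then a k else \<beta>)"
    define y' where "y' = (\<lambda>k. if k \<le> K then y k else (nxt ^^ (k - K)) (y K))"
    have y'K: "y' k = (nxt ^^ (k - K)) (y K)" if "K \<le> k" for k
      using that by (auto simp: y'_def)
    have a's: "sum a' {..<k} = s k" if "k \<le> K" for k
      unfolding s_def a'_def using that by (intro sum.cong) auto
    have "\<exists>X. confined_solution X \<and>
      (\<forall>k. sum a' {..<k} \<le> T \<longrightarrow> norm (y' k - X (sum a' {..<k})) \<le> \<epsilon> / 2)"
    proof (rule long)
      show "0 < a' k" "a' k \<le> \<beta>" for k using pos le \<beta> by (auto simp: a'_def)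
      show "y' 0 \<in> X\<^sub>0" using y0 by (simp add: y'_def)
      show "frozen_epoch (a' k) (y' k) (y' (Suc k))" for k
      proof (cases "k < K")
        case True
        then show ?thesis using step[of k] by (simp add: a'_def y'_def)
      next
        case False
        then have "y' (Suc k) = nxt (y' k)" using y'K[of k] y'K[of "Suc k"] by (simp add: Suc_diff_le)
        then show ?thesis using False nxt by (simp add: a'_def)
      qed
      have sum: "sum a' {..<K + n} = s K + real n * \<beta>" for n
        by (induction n) (simp_all add: a's, simp add: a'_def algebra_simps)
      obtain n :: nat where "T / \<beta> \<le> real n" using real_arch_simple by blast
      then have "T \<le> real n * \<beta>" using \<beta> by (simp add: pos_divide_le_eq)
      then have "T \<le> sum a' {..<K + n}" using sum[of n] s0[of K] by simp
      then show "\<exists>K. T \<le> sum a' {..<K}" by blast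
    qed
    then obtain X where X: "confined_solution X"
      and near: "\<And>k. sum a' {..<k} \<le> T \<Longrightarrow> norm (y' k - X (sum a' {..<k})) \<le> \<epsilon> / 2" by blast
    have nearK: "norm (y k - X (s k)) \<le> \<epsilon> / 2" if "k \<le> K" for k
      using near[of k] a's[OF that] sT[of k] that by (simp add: y'_def)
    have "norm (y k - X (s k)) \<le> \<epsilon>" for k
    proof (cases "k \<le> K")
      case True
      then show ?thesis using nearK[OF True] \<open>0 < \<epsilon>\<close> by simp
    next
      case False
      have yG: "y l \<in> G" for l using frozen_sequence_dom[OF y0 pos step] .
      have drift: "norm (y (K + n) - y K) \<le> C * (s (K + n) - s K)" for n
      proof (induction n)
        case (Suc n)
        have "norm (y (Suc (K + n)) - y (K + n)) \<le> C * a (K + n)"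
          using frozen_epoch_bound[OF pos order_trans[OF le \<beta>(2)] yG step] .
        then have "norm (y (Suc (K + n)) - y K) \<le> C * a (K + n) + C * (s (K + n) - s K)"
          using Suc norm_triangle_ineq[of "y (Suc (K + n)) - y (K + n)" "y (K + n) - y K"] by simp
        then show ?case by (simp add: s_def algebra_simps)
      qed simp
      have Ce: "C * (s k - s K) \<le> \<epsilon> / 4"
        using mult_left_mono[OF tail[of k] C] e by simp
      have "norm (y k - y K) \<le> \<epsilon> / 4" using drift[of "k - K"] False Ce by simp
      moreover have "norm (X (s K) - X (s k)) \<le> \<epsilon> / 4"
      proof -
        have "C-lipschitz_on {0..T} X" using X by (simp add: confined_solution_def)
        then have "norm (X (s K) - X (s k)) \<le> C * \<bar>s K - s k\<bar>"
          using lipschitz_onD[of C "{0..T}" X "s K" "s k"] s0 sT by (simp add: dist_norm less_imp_le)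
        then show ?thesis using Ce mono[of K k] False by simp
      qed
      moreover have "y k - X (s k) = (y k - y K) + (y K - X (s K)) + (X (s K) - X (s k))" by simp
      ultimately show ?thesis
        using nearK[of K] norm_triangle_ineq[of "y k - y K" "y K - X (s K)"]
          norm_triangle_ineq[of "(y k - y K) + (y K - X (s K))" "X (s K) - X (s k)"] by simp
    qed
    then show ?thesis using X unfolding s_def by blast
  qed
  then show ?thesis using \<beta>(1) by blast
qed

text \<open>A run is compared with its frozen copy. The copy is shadowed by a solution of norm at
  most \<open>R\<^sub>0\<close> with an error that keeps it strictly inside the ball of radius
  \<open>R\<close>, hence it agrees with the run up to time \<open>T\<close>.\<close>

lemma prr_sequence_shadowed:
  assumes "0 < \<epsilon>"
  shows "\<exists>\<beta>>0. \<forall>a x. (\<forall>k. 0 < a k \<and> a k \<le> \<beta>) \<and> x 0 \<in> X\<^sub>0 \<and>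
    (\<forall>k. prr_epoch N D g (a k) (x k) (x (Suc k))) \<longrightarrow>
    (\<exists>X. confined_solution X \<and> (\<forall>k. sum a {..<k} \<le> T \<longrightarrow> norm (x k - X (sum a {..<k})) \<le> \<epsilon>))"
proof -
  define \<epsilon>' where "\<epsilon>' = min \<epsilon> ((R - R\<^sub>0) / 2)"
  have \<epsilon>': "0 < \<epsilon>'" "\<epsilon>' \<le> \<epsilon>" "R\<^sub>0 + \<epsilon>' < R"
    using assms R by (auto simp: \<epsilon>'_def min_def field_simps)
  obtain \<beta> where \<beta>: "0 < \<beta>" and shadow: "\<And>a y. \<lbrakk>\<And>k. 0 < a k; \<And>k. a k \<le> \<beta>; y 0 \<in> X\<^sub>0;
      \<And>k. frozen_epoch (a k) (y k) (y (Suc k))\<rbrakk> \<Longrightarrow> \<exists>X. confined_solution X \<and>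
      (\<forall>k. sum a {..<k} \<le> T \<longrightarrow> norm (y k - X (sum a {..<k})) \<le> \<epsilon>')"
    using frozen_sequence_shadowed[OF \<epsilon>'(1)] by metis
  have "\<exists>X. confined_solution X \<and> (\<forall>k. sum a {..<k} \<le> T \<longrightarrow> norm (x k - X (sum a {..<k})) \<le> \<epsilon>)"
    if pos: "\<And>k. 0 < a k" and le: "\<And>k. a k \<le> \<beta>" and x0: "x 0 \<in> X\<^sub>0"
      and step: "\<And>k. prr_epoch N D g (a k) (x k) (x (Suc k))" for a x
  proof -
    define y where "y = rec_nat (x 0) (\<lambda>k u. if norm u < R then x (Suc k) else u)"
    have y: "y 0 = x 0" "\<And>k. y (Suc k) = (if norm (y k) < R then x (Suc k) else y k)"
      by (simp_all add: y_def)
    \<comment> \<open>A frozen iterate keeps its norm of at least \<open>R\<close> forever, so an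
      iterate of the copy inside the ball has never been frozen.\<close>
    have eq: "y k = x k" if "norm (y k) < R" for k
      using that by (cases k) (auto simp: y split: if_splits)
    have "frozen_epoch (a k) (y k) (y (Suc k))" for k
      using step[of k] eq[of k] by (cases "norm (y k) < R") (simp_all add: frozen_epoch_def y(2))
    then obtain X where X: "confined_solution X"
      and near: "\<And>k. sum a {..<k} \<le> T \<Longrightarrow> norm (y k - X (sum a {..<k})) \<le> \<epsilon>'"
      using shadow[of a y] pos le x0 y(1) by metis
    have "norm (x k - X (sum a {..<k})) \<le> \<epsilon>" if k: "sum a {..<k} \<le> T" for k
    proof -
      have "0 \<le> sum a {..<k}" using pos by (simp add: sum_nonneg less_imp_le)
      then have "norm (X (sum a {..<k})) \<le> R\<^sub>0" using X k by (simp add: confined_solution_def)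
      then have "norm (y k) < R"
        using near[OF k] \<epsilon>'(3) norm_triangle_sub[of "y k" "X (sum a {..<k})"] by linarith
      then show ?thesis using near[OF k] eq \<epsilon>'(2) by simp
    qed
    then show ?thesis using X by blast
  qed
  then show ?thesis using \<beta> by blast
qed

end

theorem lemma4p1:
  fixes N :: nat
    and f :: "nat \<Rightarrow> 'a::euclidean_space \<Rightarrow> real"
    and D :: "nat \<Rightarrow> 'a \<Rightarrow> 'a set"
    and g :: "'a \<Rightarrow> ereal"
    and X\<^sub>0 :: "'a set"
    and \<epsilon> T :: real
  assumes "1 \<le> N"
    and "\<And>i. i \<in> {1..N} \<Longrightarrow> locally_lipschitz_on UNIV (f i)"
    and "\<And>i. i \<in> {1..N} \<Longrightarrow> conservative_field (f i) (D i)"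
    and "\<And>i. i \<in> {1..N} \<Longrightarrow> locally_bounded_map (D i)"
    and "\<And>i x. i \<in> {1..N} \<Longrightarrow> D i x \<noteq> {} \<and> convex (D i x)"
    and "proper_fun g" and "convex_ereal g" and "closed (eff_dom g)"
    and "locally_lipschitz_on (eff_dom g) (\<lambda>x. real_of_ereal (g x))"
    and "\<exists>m::real. \<forall>x. ereal m \<le> objective N f g x"
    and "compact X\<^sub>0" and "X\<^sub>0 \<subseteq> eff_dom (objective N f g)"
    and "0 < \<epsilon>" and "0 < T"
  shows "\<exists>\<alpha>\<^sub>m\<^sub>a\<^sub>x>0. \<forall>(\<alpha> :: nat \<Rightarrow> real) (x :: nat \<Rightarrow> 'a).
    prr_sequence N f D g \<alpha> x \<and> x 0 \<in> X\<^sub>0 \<and> (\<forall>k. \<alpha> k \<in> {0<..\<alpha>\<^sub>m\<^sub>a\<^sub>x}) \<longrightarrow>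
    (\<exists>X :: real \<Rightarrow> 'a.
      inclusion_solution T (objective_field N D g) X \<and>
      X ` {0..T} \<subseteq> eff_dom (objective N f g) \<and>
      X 0 \<in> X\<^sub>0 \<and>
      (\<forall>k\<ge>1. (\<Sum>j<k. \<alpha> j) \<le> T \<longrightarrow> norm (x k - X (\<Sum>j<k. \<alpha> j)) \<le> \<epsilon>))"
proof -
  obtain m :: real where m: "\<And>x. ereal m \<le> objective N f g x" using assms(10) by blast
  interpret prr g N f D m
    by unfold_locales (use assms m in blast)+
  have X\<^sub>0: "compact X\<^sub>0" "X\<^sub>0 \<subseteq> G" using assms(11,12) by (simp_all add: eff_dom_objective)
  obtain \<rho> where \<rho>: "\<And>x. x \<in> X\<^sub>0 \<Longrightarrow> norm x \<le> \<rho>"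
    using compact_imp_bounded[OF X\<^sub>0(1)] by (auto simp: bounded_iff)
  have "\<exists>L. L-lipschitz_on X\<^sub>0 (\<lambda>x. \<Sum>i=1..N. f i x)"
    using locally_lipschitz_on_compact[OF D_props(4) X\<^sub>0(1)] by (intro lipschitz_on_sum) blast
  then obtain L where L: "L-lipschitz_on X\<^sub>0 (\<lambda>x. \<Sum>i=1..N. f i x)" by blast
  have "continuous_on X\<^sub>0 (\<lambda>x. \<Phi> x)"
    by (intro continuous_on_add lipschitz_on_continuous_on[OF L]
      continuous_on_subset[OF continuous_on_dom X\<^sub>0(2)])
  then have "bounded ((\<lambda>x. \<Phi> x) ` X\<^sub>0)"
    by (intro compact_imp_bounded compact_continuous_image X\<^sub>0(1))
  then obtain B where "\<And>x. x \<in> X\<^sub>0 \<Longrightarrow> \<bar>\<Phi> x\<bar> \<le> B" by (auto simp: bounded_iff)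
  then have B: "\<And>x. x \<in> X\<^sub>0 \<Longrightarrow> \<Phi> x \<le> B" by (meson abs_le_D1)
  \<comment> \<open>The summand 1 is a margin above the a priori bound on solutions; any positive
    number would serve.\<close>
  define R where "R = \<rho> + (T + (B - m)) / 2 + 1"
  obtain \<alpha>\<^sub>0 C where const: "0 < \<alpha>\<^sub>0" "0 \<le> C"
    "\<And>\<alpha> x y. \<lbrakk>0 < \<alpha>; \<alpha> \<le> \<alpha>\<^sub>0; x \<in> G; norm x \<le> R; prr_epoch N D g \<alpha> x y\<rbrakk> \<Longrightarrow> norm (y - x) \<le> C * \<alpha>"
    "\<And>p \<eta>. \<lbrakk>norm p < R; 0 < \<eta>\<rbrakk> \<Longrightarrow> \<exists>\<delta>>0. \<forall>\<alpha> x y. norm (x - p) < \<delta> \<and> 0 < \<alpha> \<and> \<alpha> < \<delta> \<longrightarrow>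
      norm x < R \<and> (x \<in> G \<and> prr_epoch N D g \<alpha> x y \<longrightarrow>
        (\<exists>d\<in>D\<^sub>\<Phi> p. norm ((1 / \<alpha>) *\<^sub>R (x - y) - d) \<le> \<eta>))"
    using prr_epoch_velocity[of R] by metis
  interpret prr_horizon g N f D m X\<^sub>0 T \<rho> B R \<alpha>\<^sub>0 C
    by unfold_locales (fact X\<^sub>0 \<open>0 < T\<close> \<rho> B const | simp add: R_def)+
  obtain \<beta> where \<beta>: "0 < \<beta>" and shadow: "\<And>a x. \<lbrakk>\<And>k. 0 < a k; \<And>k. a k \<le> \<beta>; x 0 \<in> X\<^sub>0;
      \<And>k. prr_epoch N D g (a k) (x k) (x (Suc k))\<rbrakk> \<Longrightarrow> \<exists>X. confined_solution X \<and>
      (\<forall>k. sum a {..<k} \<le> T \<longrightarrow> norm (x k - X (sum a {..<k})) \<le> \<epsilon>)"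
    using prr_sequence_shadowed[OF \<open>0 < \<epsilon>\<close>] by metis
  show ?thesis
  proof (intro exI[of _ \<beta>] conjI allI impI \<beta>)
    fix \<alpha> x assume asm: "prr_sequence N f D g \<alpha> x \<and> x 0 \<in> X\<^sub>0 \<and> (\<forall>k. \<alpha> k \<in> {0<..\<beta>})"
    then have "\<exists>X. confined_solution X \<and>
        (\<forall>k. sum \<alpha> {..<k} \<le> T \<longrightarrow> norm (x k - X (sum \<alpha> {..<k})) \<le> \<epsilon>)"
      using prr_sequence_epoch by (intro shadow) auto
    then show "\<exists>X. inclusion_solution T (objective_field N D g) X \<and>
      X ` {0..T} \<subseteq> eff_dom (objective N f g) \<and> X 0 \<in> X\<^sub>0 \<and>
      (\<forall>k\<ge>1. (\<Sum>j<k. \<alpha> j) \<le> T \<longrightarrow> norm (x k - X (\<Sum>j<k. \<alpha> j)) \<le> \<epsilon>)"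
      unfolding confined_solution_def eff_dom_objective by blast
  qed
qed

end
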